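(* Let $P$ be a spiral on $n$ nodes with $k=O(\log n)$ turning points $(tp_1,\dots,tp_k)$, $tp_1$ being the internal and $tp_k$ the external endpoint. Then in the connectivity graph model $P$ can be grown from a single node placed at $tp_k$ in $O(\log n)$ time steps.
   Context: Shapes. Grid points are integer pairs $(x,y)$; two grid points are adjacent if they are at orthogonal (Manhattan) distance $1$. A shape $S=(V,E)$ is a finite connected graph whose nodes occupy distinct grid points and whose edges join only pairs of nodes occupying adjacent points; shapes are considered up to translation, and $n=|V|$. Growth operations. One node, the anchor $u_0$, is stationary; other nodes move relative to it, and a tree is rooted at $u_0$. A growth operation on a node $u$ toward an adjacent grid point $p$ either (i) if $u$ has no edge to $p$, creates a new node $u'$ at $p$ with edge $uu'$; or (ii) if $p$ is occupied by a node $v$ with $uv\in E$, creates a new node $u'$ at $p$, replaces edge $uv$ by edges $uu',u'v$, and translates by one unit, along the axis of $uv$, the part of the tree hanging from whichever of $u,v$ is farther from $u_0$, away from the other endpoint. In one time step a set of operations is applied concurrently, each node receiving at most one operation and all operations having the same cardinal direction; the displacement of each node is the sum of the unit vectors contributed by the operations on its path to $u_0$. The set is collision-free if no two nodes collide during these motions or end at the same point. Growth processes (connectivity graph model). A growth process from an initial shape $S_0$ performs time steps $t=1,2,\dots$, each applying a collision-free set of growth operations to the current shape; no edges are deleted and no edges are created other than by the operations. It grows $S$ from $S_0$ in $t_f$ time steps if the shape obtained after step $t_f$ is $S$. Paths and spirals. For a path $P=(u_1,\dots,u_n)$, $u_i$ is a turning point if $i\in\{1,n\}$ or $u_{i-1}u_i\perp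 u_iu_{i+1}$. A spiral is a path whose turning points, ordered from one endpoint to the other, follow consecutive cardinal directions in a single rotational sense (always clockwise or always counterclockwise). A single spiral winds outward without self-intersection from an internal endpoint $tp_1$ to an external endpoint $tp_k$; segment $s_i$ joins $tp_i$ and $tp_{i+1}$. *)

theory Defs
  imports Complex_Main "HOL-Library.Product_Plus"
begin

type_synonym pt = "int \<times> int"

text \<open>A shape is represented by the set of occupied grid points (its nodes, which occupy
distinct points) together with its edges, each edge being the two-element set of the
points of its endpoints.\<close>
type_synonym shape = "pt set \<times> pt set set"

definition grid_adj :: "pt \<Rightarrow> pt \<Rightarrow> bool" where
  "grid_adj p q \<longleftrightarrow> \<bar>fst p - fst q\<bar> + \<bar>snd p - snd q\<bar> = 1"

definition cardinal_dirs :: "pt set" where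
  "cardinal_dirs = {(1,0), (-1,0), (0,1), (0,-1)}"

definition walk :: "pt set set \<Rightarrow> pt list \<Rightarrow> bool" where
  "walk E xs \<longleftrightarrow> xs \<noteq> [] \<and> (\<forall>i. Suc i < length xs \<longrightarrow> {xs ! i, xs ! Suc i} \<in> E)"

definition gdist :: "pt set set \<Rightarrow> pt \<Rightarrow> pt \<Rightarrow> nat" where
  "gdist E a y = (LEAST m. \<exists>xs. walk E xs \<and> hd xs = y \<and> last xs = a \<and> length xs = Suc m)"

text \<open>The part of the tree (rooted at the anchor a) hanging from x: the nodes whose
path to the anchor passes through x.\<close>
definition hanging :: "shape \<Rightarrow> pt \<Rightarrow> pt \<Rightarrow> pt set" where
  "hanging S a x = {y \<in> fst S. \<forall>xs. walk (snd S) xs \<and> hd xs = y \<and> last xs = a \<longrightarrow> x \<in> set xs}"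

text \<open>A time step is given by a set Ops of nodes receiving an operation (each node at most
one) and a common cardinal direction d; the operation on u is toward the point u + d.\<close>

definition is_split :: "shape \<Rightarrow> pt \<Rightarrow> pt \<Rightarrow> bool" where
  "is_split S d u \<longleftrightarrow> {u, u + d} \<in> snd S"

definition far_end :: "shape \<Rightarrow> pt \<Rightarrow> pt \<Rightarrow> pt \<Rightarrow> pt" where
  "far_end S a d u = (if gdist (snd S) a u < gdist (snd S) a (u + d) then u + d else u)"

definition near_end :: "shape \<Rightarrow> pt \<Rightarrow> pt \<Rightarrow> pt \<Rightarrow> pt" where
  "near_end S a d u = (if gdist (snd S) a u < gdist (snd S) a (u + d) then u else u + d)"

text \<open>Unit vector contributed by a split operation: the farther part moves away from the
nearer endpoint.\<close>
definition contrib :: "shape \<Rightarrow> pt \<Rightarrow> pt \<Rightarrow> pt \<Rightarrow> pt" where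
  "contrib S a d u = far_end S a d u - near_end S a d u"

text \<open>Displacement of an existing node y: sum of the contributions of the operations on
its path to the anchor.\<close>
definition disp :: "shape \<Rightarrow> pt \<Rightarrow> pt set \<Rightarrow> pt \<Rightarrow> pt \<Rightarrow> pt" where
  "disp S a Ops d y =
     (\<Sum>u \<in> {u \<in> Ops. is_split S d u \<and> y \<in> hanging S a (far_end S a d u)}. contrib S a d u)"

text \<open>The new node created by the operation on u: its creation point and its displacement.
In case (i) it is created at u + d and moves with u; in case (ii) it is inserted between u
and v = u + d at the old position of the farther endpoint and moves with the nearer one.\<close>
definition new_start :: "shape \<Rightarrow> pt \<Rightarrow> pt \<Rightarrow> pt \<Rightarrow> pt" where
  "new_start S a d u = (if is_split S d u then far_end S a d u else u + d)"

definition new_disp :: "shape \<Rightarrow> pt \<Rightarrow> pt set \<Rightarrow> pt \<Rightarrow> pt \<Rightarrow> pt" where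
  "new_disp S a Ops d u =
     (if is_split S d u then disp S a Ops d (near_end S a d u) else disp S a Ops d u)"

text \<open>Movers: old nodes (Inl) and newly created nodes (Inr, indexed by the node that
received the operation).\<close>
definition mover_start :: "shape \<Rightarrow> pt \<Rightarrow> pt \<Rightarrow> pt + pt \<Rightarrow> pt" where
  "mover_start S a d m = (case m of Inl y \<Rightarrow> y | Inr u \<Rightarrow> new_start S a d u)"

definition mover_disp :: "shape \<Rightarrow> pt \<Rightarrow> pt set \<Rightarrow> pt \<Rightarrow> pt + pt \<Rightarrow> pt" where
  "mover_disp S a Ops d m = (case m of Inl y \<Rightarrow> disp S a Ops d y | Inr u \<Rightarrow> new_disp S a Ops d u)"

definition traj :: "shape \<Rightarrow> pt \<Rightarrow> pt set \<Rightarrow> pt \<Rightarrow> pt + pt \<Rightarrow> real \<Rightarrow> real \<times> real" where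
  "traj S a Ops d m t =
     (let p = mover_start S a d m; q = mover_disp S a Ops d m
      in (real_of_int (fst p) + t * real_of_int (fst q), real_of_int (snd p) + t * real_of_int (snd q)))"

definition collision_free :: "shape \<Rightarrow> pt \<Rightarrow> pt set \<Rightarrow> pt \<Rightarrow> bool" where
  "collision_free S a Ops d \<longleftrightarrow>
     (\<forall>m1 \<in> Inl ` fst S \<union> Inr ` Ops. \<forall>m2 \<in> Inl ` fst S \<union> Inr ` Ops. m1 \<noteq> m2 \<longrightarrow>
        (\<forall>t::real. 0 < t \<and> t \<le> 1 \<longrightarrow> traj S a Ops d m1 t \<noteq> traj S a Ops d m2 t))"

definition final_pos :: "shape \<Rightarrow> pt \<Rightarrow> pt set \<Rightarrow> pt \<Rightarrow> pt + pt \<Rightarrow> pt" where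
  "final_pos S a Ops d m = mover_start S a d m + mover_disp S a Ops d m"

definition step_result :: "shape \<Rightarrow> pt \<Rightarrow> pt set \<Rightarrow> pt \<Rightarrow> shape" where
  "step_result S a Ops d =
     (let f = final_pos S a Ops d in
      (f ` (Inl ` fst S \<union> Inr ` Ops),
       {{f (Inl x), f (Inl y)} | x y. {x, y} \<in> snd S \<and>
            \<not> (\<exists>u \<in> Ops. is_split S d u \<and> {x, y} = {u, u + d})}
       \<union> {{f (Inl u), f (Inr u)} | u. u \<in> Ops}
       \<union> {{f (Inr u), f (Inl (u + d))} | u. u \<in> Ops \<and> is_split S d u}))"

definition valid_step :: "shape \<Rightarrow> pt \<Rightarrow> shape \<Rightarrow> bool" where
  "valid_step S a S' \<longleftrightarrow>
     (\<exists>Ops d. Ops \<subseteq> fst S \<and> d \<in> cardinal_dirs \<and> collision_free S a Ops d \<and> S' = step_result S a Ops d)"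

text \<open>Growth process with anchor a (a node of the initial shape, kept stationary):
S is grown from S0 in t time steps.\<close>
definition grows_in :: "shape \<Rightarrow> pt \<Rightarrow> shape \<Rightarrow> nat \<Rightarrow> bool" where
  "grows_in S0 a S t \<longleftrightarrow>
     a \<in> fst S0 \<and>
     (\<exists>seq :: nat \<Rightarrow> shape. seq 0 = S0 \<and> seq t = S \<and> (\<forall>i < t. valid_step (seq i) a (seq (Suc i))))"

definition grid_path :: "pt list \<Rightarrow> bool" where
  "grid_path ps \<longleftrightarrow> ps \<noteq> [] \<and> distinct ps \<and>
     (\<forall>i. Suc i < length ps \<longrightarrow> grid_adj (ps ! i) (ps ! Suc i))"

definition path_shape :: "pt list \<Rightarrow> shape" where
  "path_shape ps = (set ps, {{ps ! i, ps ! Suc i} | i. Suc i < length ps})"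

definition step_dir :: "pt list \<Rightarrow> nat \<Rightarrow> pt" where
  "step_dir ps i = ps ! Suc i - ps ! i"

definition perp :: "pt \<Rightarrow> pt \<Rightarrow> bool" where
  "perp p q \<longleftrightarrow> fst p * fst q + snd p * snd q = 0"

definition turning_point :: "pt list \<Rightarrow> nat \<Rightarrow> bool" where
  "turning_point ps i \<longleftrightarrow> i < length ps \<and>
     (i = 0 \<or> i = length ps - 1 \<or> perp (step_dir ps (i - 1)) (step_dir ps i))"

definition num_turning_points :: "pt list \<Rightarrow> nat" where
  "num_turning_points ps = card {i. turning_point ps i}"

definition rot_ccw :: "pt \<Rightarrow> pt" where "rot_ccw p = (- snd p, fst p)"
definition rot_cw :: "pt \<Rightarrow> pt" where "rot_cw p = (snd p, - fst p)"

definition spiral :: "pt list \<Rightarrow> bool" where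
  "spiral ps \<longleftrightarrow> grid_path ps \<and>
     (\<exists>rot \<in> {rot_ccw, rot_cw}. \<forall>i. Suc (Suc i) < length ps \<longrightarrow>
        step_dir ps (Suc i) = step_dir ps i \<or> step_dir ps (Suc i) = rot (step_dir ps i))"

text \<open>The last node of the list is the external endpoint: the ray continuing the last
segment beyond it meets no node of the spiral (the spiral winds outward toward it).\<close>
definition last_is_external :: "pt list \<Rightarrow> bool" where
  "last_is_external ps \<longleftrightarrow>
     (2 \<le> length ps \<longrightarrow>
       (let e = last ps; d = step_dir ps (length ps - 2) in
        \<forall>m::nat. 1 \<le> m \<longrightarrow> (fst e + int m * fst d, snd e + int m * snd d) \<notin> set ps))"

end

theory Submission
  imports Defs
begin

text \<open>The spiral is read from its external endpoint, which is the anchor, inwards: it is the list of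
its segment lengths, outermost first. Since it is self-avoiding and its last segment can be prolonged
outwards for ever, every segment from the second one on is longer than the next segment parallel to
it (a segment reaching as far as the second one before it would hit the third one before it). Call
such lists nested; conversely, they yield self-avoiding spirals.

The growth process is constructed backwards. A step on one axis can undo splits of any set of
parallel edges that leaves each segment at least half of its length. A segment of a nested list that
is followed by \<open>r\<close> others has length at least \<open>(r + 2) div 2\<close>, and halving the excess over this
bound, once for each axis, keeps the list nested. After about \<open>log n\<close> such rounds the spiral is as
tight as possible and its innermost segment is a single edge, which is removed. The excesses are then
at most \<open>1\<close>, so one more round makes the remaining spiral tight again. This gives
\<open>2 log n + 3 k\<close> steps up to rounding.

No two nodes collide in these steps: an outer segment is separated from everything inside it by a
line, before and after the step alike.\<close>

section \<open>Paths\<close>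

text \<open>A path is encoded by its start and the word of its steps: a split translates a whole
  tail of the path, but it changes the word only locally.\<close>

fun pts :: "pt \<Rightarrow> pt list \<Rightarrow> pt list" where
  "pts p [] = [p]"
| "pts p (w # ws) = p # pts (p + w) ws"

lemma length_pts [simp]: "length (pts p ws) = Suc (length ws)"
  by (induction ws arbitrary: p) auto

lemma pts_neq_Nil [simp]: "pts p ws \<noteq> []"
  by (cases ws) auto

lemma nth_pts: "i \<le> length ws \<Longrightarrow> pts p ws ! i = p + sum_list (take i ws)"
proof (induction ws arbitrary: p i)
  case (Cons w ws)
  then show ?case by (cases i) (auto simp: add.assoc)
qed simp

lemma last_pts: "last (pts p ws) = p + sum_list ws"
  by (simp add: last_conv_nth nth_pts)

lemma pts_append: "pts p (us @ ws) = pts p us @ tl (pts (p + sum_list us) ws)"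
proof (induction us arbitrary: p)
  case Nil
  then show ?case by (cases ws) auto
qed (auto simp: add.assoc)

lemma path_shape_Cons:
  "path_shape (x # y # zs) = (insert x (fst (path_shape (y # zs))), insert {x, y} (snd (path_shape (y # zs))))"
proof -
  have "{{(x # y # zs) ! i, (x # y # zs) ! Suc i} | i. Suc i < length (x # y # zs)}
    = insert {x, y} {{(y # zs) ! i, (y # zs) ! Suc i} | i. Suc i < length (y # zs)}" (is "?L = ?R")
  proof
    show "?L \<subseteq> ?R"
    proof
      fix e assume "e \<in> ?L"
      then obtain i where i: "e = {(x # y # zs) ! i, (x # y # zs) ! Suc i}" "Suc i < length (x # y # zs)"
        by blast
      then show "e \<in> ?R" by (cases i) auto
    qed
    show "?R \<subseteq> ?L"
    proof
      fix e assume "e \<in> ?R"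
      then consider "e = {x, y}" | i where "e = {(y # zs) ! i, (y # zs) ! Suc i}" "Suc i < length (y # zs)"
        by blast
      then show "e \<in> ?L"
      proof cases
        case 1
        then show ?thesis by (intro CollectI exI[of _ 0]) auto
      next
        case (2 i)
        then show ?thesis by (intro CollectI exI[of _ "Suc i"]) auto
      qed
    qed
  qed
  then show ?thesis by (simp add: path_shape_def)
qed

text \<open>Edges are unordered. This lets the spiral, given from its internal endpoint, be grown as
  a list that starts at the anchor.\<close>

lemma path_shape_rev: "path_shape (rev xs) = path_shape xs"
proof -
  have sub: "snd (path_shape (rev xs)) \<subseteq> snd (path_shape xs)" for xs :: "pt list"
  proof
    fix e assume "e \<in> snd (path_shape (rev xs))"
    then obtain i where i: "e = {rev xs ! i, rev xs ! Suc i}" "Suc i < length xs"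
      by (auto simp: path_shape_def)
    let ?j = "length xs - Suc (Suc i)"
    have "rev xs ! i = xs ! Suc ?j" "rev xs ! Suc i = xs ! ?j" "Suc ?j < length xs"
      using i(2) by (auto simp: rev_nth Suc_diff_Suc)
    then show "e \<in> snd (path_shape xs)"
      using i(1) by (auto simp: path_shape_def)
  qed
  have "snd (path_shape (rev xs)) = snd (path_shape xs)"
    using sub[of xs] sub[of "rev xs"] by auto
  then show ?thesis by (simp add: path_shape_def)
qed

lemma fst_path_shape [simp]: "fst (path_shape xs) = set xs"
  by (simp add: path_shape_def)

section \<open>Walks, distances and hanging nodes in a path\<close>

lemma walk_Cons: "walk E (x # y # zs) \<longleftrightarrow> {x, y} \<in> E \<and> walk E (y # zs)"
proof
  assume w: "walk E (x # y # zs)"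
  then have h: "\<And>i. Suc i < length (x # y # zs) \<Longrightarrow> {(x # y # zs) ! i, (x # y # zs) ! Suc i} \<in> E"
    by (auto simp: walk_def)
  have "{x, y} \<in> E" using h[of 0] by simp
  moreover have "walk E (y # zs)" unfolding walk_def
    using h[of "Suc i" for i] by simp
  ultimately show "{x, y} \<in> E \<and> walk E (y # zs)" ..
next
  assume a: "{x, y} \<in> E \<and> walk E (y # zs)"
  show "walk E (x # y # zs)" unfolding walk_def
  proof (intro conjI allI impI)
    fix i assume "Suc i < length (x # y # zs)"
    with a show "{(x # y # zs) ! i, (x # y # zs) ! Suc i} \<in> E"
      by (cases i) (auto simp: walk_def)
  qed simp
qed

lemma path_edge_neighbour:
  assumes "distinct xs" "j < length xs" "{xs ! j, z} \<in> snd (path_shape xs)"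
  obtains j' where "j' < length xs" "z = xs ! j'" "j' = Suc j \<or> j = Suc j'"
proof -
  obtain i where i: "Suc i < length xs" "{xs ! j, z} = {xs ! i, xs ! Suc i}"
    using assms(3) by (auto simp: path_shape_def)
  from i(2) consider "xs ! j = xs ! i" "z = xs ! Suc i" | "xs ! j = xs ! Suc i" "z = xs ! i"
    by (auto simp: doubleton_eq_iff)
  then show ?thesis
  proof cases
    case 1
    then have "j = i" using assms i by (simp add: nth_eq_iff_index_eq)
    then show ?thesis using that[of "Suc i"] 1 i by simp
  next
    case 2
    then have "j = Suc i" using assms i by (simp add: nth_eq_iff_index_eq)
    then show ?thesis using that[of i] 2 i by simp
  qed
qed

text \<open>Every edge of a walk changes the index along the path by exactly one. Counting nodes
  additively avoids a truncated difference.\<close>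

lemma walk_length_ge:
  assumes "distinct xs" "walk (snd (path_shape xs)) zs" "hd zs = xs ! j" "j < length xs"
    "last zs = xs ! i" "i < length xs"
  shows "j < i + length zs"
  using assms(2-4,5)
proof (induction zs arbitrary: j rule: induct_list012)
  case 1
  then show ?case by (simp add: walk_def)
next
  case (2 x)
  then show ?case using assms(1,6) by (auto simp: nth_eq_iff_index_eq)
next
  case (3 x y zs)
  then have e: "{xs ! j, y} \<in> snd (path_shape xs)" "walk (snd (path_shape xs)) (y # zs)"
    by (auto simp: walk_Cons)
  obtain j' where j': "j' < length xs" "y = xs ! j'" "j' = Suc j \<or> j = Suc j'"
    using path_edge_neighbour[OF assms(1) _ e(1)] 3 by blast
  have "j' < i + length (y # zs)"
    using 3 e j' by simp
  then show ?case using j' by auto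
qed

text \<open>A discrete intermediate value argument: the index changes by one per edge, so on its way
  down to \<open>0\<close> it cannot skip \<open>i\<close>.\<close>

lemma walk_passes:
  assumes "distinct xs" "walk (snd (path_shape xs)) zs" "hd zs = xs ! j" "j < length xs"
    "last zs = xs ! 0" "i \<le> j"
  shows "xs ! i \<in> set zs"
  using assms(2-)
proof (induction zs arbitrary: j rule: induct_list012)
  case 1
  then show ?case by (simp add: walk_def)
next
  case (2 x)
  then have "j = 0" using assms(1) by (metis hd_conv_nth last.simps length_greater_0_conv length_pos_if_in_set
        list.sel(1) nth_eq_iff_index_eq gr_zeroI not_less_zero)
  then show ?case using 2 by simp
next
  case (3 x y zs)
  show ?case
  proof (cases "i = j")
    case True
    then show ?thesis using 3 by simp
  next
    case False
    from 3 have e: "{xs ! j, y} \<in> snd (path_shape xs)" "walk (snd (path_shape xs)) (y # zs)"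
      by (auto simp: walk_Cons)
    obtain j' where j': "j' < length xs" "y = xs ! j'" "j' = Suc j \<or> j = Suc j'"
      using path_edge_neighbour[OF assms(1) _ e(1)] 3 by blast
    have "i \<le> j'" using j' False 3 by auto
    then have "xs ! i \<in> set (y # zs)" using 3 e j' by simp
    then show ?thesis by simp
  qed
qed

text \<open>The direct walk to the first node attains the lower bound on the length, which gives
  \<open>gdist\<close>, and visits no index above \<open>j\<close>, which gives
  \<open>hanging\<close>.\<close>

lemma walk_back:
  assumes "j < length xs"
  defines "zs \<equiv> map (\<lambda>k. xs ! (j - k)) [0..<Suc j]"
  shows "walk (snd (path_shape xs)) zs" "hd zs = xs ! j" "last zs = xs ! 0"
    "length zs = Suc j" "set zs = (!) xs ` {..j}"
proof -
  show l: "length zs = Suc j" by (simp add: zs_def)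
  have ne: "zs \<noteq> []" using l by auto
  have nth: "zs ! k = xs ! (j - k)" if "k < Suc j" for k
    using that by (simp add: zs_def del: upt_Suc)
  show "hd zs = xs ! j" using ne nth by (simp add: hd_conv_nth)
  show "last zs = xs ! 0" using ne nth l by (simp add: last_conv_nth)
  show "walk (snd (path_shape xs)) zs" unfolding walk_def
  proof (intro conjI allI impI ne)
    fix k assume "Suc k < length zs"
    then have k: "Suc k < Suc j" using l by simp
    then have "{zs ! k, zs ! Suc k} = {xs ! (j - Suc k), xs ! Suc (j - Suc k)}"
      using nth[of k] nth[of "Suc k"] by (auto simp: Suc_diff_Suc)
    then show "{zs ! k, zs ! Suc k} \<in> snd (path_shape xs)"
      using k assms(1) by (auto simp: path_shape_def intro!: exI[of _ "j - Suc k"])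
  qed
  show "set zs = (!) xs ` {..j}"
  proof -
    have "(\<lambda>k. j - k) ` {0..<Suc j} = {..j}"
    proof
      show "{..j} \<subseteq> (\<lambda>k. j - k) ` {0..<Suc j}"
      proof
        fix x assume "x \<in> {..j}"
        then show "x \<in> (\<lambda>k. j - k) ` {0..<Suc j}"
          by (intro image_eqI[of _ _ "j - x"]) auto
      qed
    qed auto
    then show ?thesis unfolding zs_def set_map set_upt
      by (metis image_image)
  qed
qed

lemma gdist_path:
  assumes "distinct xs" "j < length xs"
  shows "gdist (snd (path_shape xs)) (xs ! 0) (xs ! j) = j"
  unfolding gdist_def
proof (rule Least_equality)
  show "\<exists>zs. walk (snd (path_shape xs)) zs \<and> hd zs = xs ! j \<and> last zs = xs ! 0 \<and> length zs = Suc j"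
    using walk_back[OF assms(2)] by blast
next
  fix m assume "\<exists>zs. walk (snd (path_shape xs)) zs \<and> hd zs = xs ! j \<and> last zs = xs ! 0 \<and> length zs = Suc m"
  then obtain zs where "walk (snd (path_shape xs)) zs" "hd zs = xs ! j" "last zs = xs ! 0" "length zs = Suc m"
    by blast
  then show "j \<le> m"
    using walk_length_ge[OF assms(1), of zs j 0] assms(2) by fastforce
qed

lemma hanging_path:
  assumes "distinct xs" "i < length xs" "j < length xs"
  shows "xs ! j \<in> hanging (path_shape xs) (xs ! 0) (xs ! i) \<longleftrightarrow> i \<le> j"
proof
  assume "xs ! j \<in> hanging (path_shape xs) (xs ! 0) (xs ! i)"
  then have "xs ! i \<in> (!) xs ` {..j}"
    using walk_back[OF assms(3)] unfolding hanging_def by blast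
  then show "i \<le> j"
    using assms by (auto simp: nth_eq_iff_index_eq)
next
  assume "i \<le> j"
  then show "xs ! j \<in> hanging (path_shape xs) (xs ! 0) (xs ! i)"
    using walk_passes[OF assms(1)] assms(3) by (auto simp: hanging_def)
qed

lemma path_edge_eq_iff:
  assumes "distinct xs" "Suc i < length xs" "Suc k < length xs"
  shows "{xs ! i, xs ! Suc i} = {xs ! k, xs ! Suc k} \<longleftrightarrow> i = k"
  using assms by (auto simp: doubleton_eq_iff nth_eq_iff_index_eq)

section \<open>Collision-free steps on paths\<close>

definition dot :: "pt \<Rightarrow> pt \<Rightarrow> int" where
  "dot v p = fst v * fst p + snd v * snd p"

lemma dot_add [simp]: "dot v (p + q) = dot v p + dot v q"
  by (simp add: dot_def algebra_simps)

lemma dot_zero [simp]: "dot v 0 = 0"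
  by (simp add: dot_def)

lemma dot_uminus_right [simp]: "dot v (- p) = - dot v p"
  by (simp add: dot_def)

lemma dot_diff [simp]: "dot v (p - q) = dot v p - dot v q"
  by (simp add: dot_def algebra_simps)

lemma dot_uminus_left [simp]: "dot (- v) p = - dot v p"
  by (simp add: dot_def)

text \<open>Two nodes moving uniformly from their start to their final points do not meet if some linear
functional separates the final points strictly and the start points weakly in the same order.\<close>

definition separated :: "pt \<times> pt \<Rightarrow> pt \<times> pt \<Rightarrow> bool" where
  "separated m m' \<longleftrightarrow> (\<exists>v. dot v (fst m) \<le> dot v (fst m') \<and> dot v (snd m) < dot v (snd m'))"

lemma separatedI:
  "dot v (fst m) \<le> dot v (fst m') \<Longrightarrow> dot v (snd m) < dot v (snd m') \<Longrightarrow> separated m m'"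
  unfolding separated_def by blast

lemma separated_sym: "separated m m' \<Longrightarrow> separated m' m"
  unfolding separated_def
proof (elim exE)
  fix v assume "dot v (fst m) \<le> dot v (fst m') \<and> dot v (snd m) < dot v (snd m')"
  then show "\<exists>v. dot v (fst m') \<le> dot v (fst m) \<and> dot v (snd m') < dot v (snd m)"
    by (intro exI[of _ "- v"]) simp
qed

text \<open>At time \<open>t\<close> a mover is the convex combination of its start and its final
  point with weights \<open>1 - t\<close> and \<open>t\<close>. Since \<open>t > 0\<close>, the
  strict inequality at the end survives. Equality at the start must be allowed because a new node
  may start where an old node is.\<close>

lemma traj_neq_if_separated:
  assumes "separated (mover_start S a d m, final_pos S a Ops d m)
    (mover_start S a d m', final_pos S a Ops d m')" "0 < t" "t \<le> 1"
  shows "traj S a Ops d m t \<noteq> traj S a Ops d m' t"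
proof
  assume eq: "traj S a Ops d m t = traj S a Ops d m' t"
  define s s' e e' where defs: "s = mover_start S a d m" "s' = mover_start S a d m'"
    "e = mover_disp S a Ops d m" "e' = mover_disp S a Ops d m'"
  obtain v where v: "dot v s \<le> dot v s'" "dot v s + dot v e < dot v s' + dot v e'"
    using assms(1) by (auto simp: separated_def final_pos_def defs)
  have e: "real_of_int (fst s) + t * fst e = fst s' + t * fst e'"
    "real_of_int (snd s) + t * snd e = snd s' + t * snd e'"
    using eq by (auto simp: traj_def Let_def defs)
  have "real_of_int (dot v s) + t * dot v e
      = fst v * (fst s + t * fst e) + snd v * (snd s + t * snd e)"
    by (simp add: dot_def algebra_simps)
  also have "\<dots> = fst v * (fst s' + t * fst e') + snd v * (snd s' + t * snd e')"
    by (simp only: e)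
  also have "\<dots> = real_of_int (dot v s') + t * dot v e'"
    by (simp add: dot_def algebra_simps)
  finally have 1: "real_of_int (dot v s) + t * dot v e = dot v s' + t * dot v e'" .
  have "(1 - t) * real_of_int (dot v s) \<le> (1 - t) * dot v s'"
    using v(1) assms(3) by (intro mult_left_mono) auto
  moreover have "real_of_int (dot v s + dot v e) < dot v s' + dot v e'"
    using v(2) by linarith
  then have "t * real_of_int (dot v s + dot v e) < t * (dot v s' + dot v e')"
    using assms(2) by (intro mult_strict_left_mono) auto
  ultimately show False using 1 by (simp add: algebra_simps)
qed

section \<open>Extending a path at its free end\<close>

text \<open>The target is unoccupied, so no edge leads to it and the single operation is not a
  split. Hence all displacements vanish, and the movers stay at their distinct starts.\<close>

lemma valid_step_extend:
  assumes "distinct xs" "xs \<noteq> []" "d \<in> cardinal_dirs" "last xs + d \<notin> set xs"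
  shows "valid_step (path_shape xs) a (path_shape (xs @ [last xs + d]))"
proof -
  let ?S = "path_shape xs" and ?u = "last xs"
  have ns: "\<not> is_split ?S d ?u"
  proof
    assume "is_split ?S d ?u"
    then obtain i where "{?u, ?u + d} = {xs ! i, xs ! Suc i}" "Suc i < length xs"
      by (auto simp: is_split_def path_shape_def)
    then have "?u + d \<in> set xs"
      by (metis insertCI insertE nth_mem singletonD Suc_lessD)
    then show False using assms by simp
  qed
  have disp: "disp ?S a {?u} d y = 0" for y
    using ns by (auto simp: disp_def intro!: sum.neutral)
  have st: "mover_start ?S a d (Inl y) = y" "mover_start ?S a d (Inr ?u) = ?u + d" for y
    using ns by (auto simp: mover_start_def new_start_def)
  have md: "mover_disp ?S a {?u} d m = 0" if "m \<in> Inl ` set xs \<union> Inr ` {?u}" for m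
    using that ns by (auto simp: mover_disp_def new_disp_def disp)
  have fin: "final_pos ?S a {?u} d (Inl y) = y" "final_pos ?S a {?u} d (Inr ?u) = ?u + d"
    if "y \<in> set xs" for y
    using st md disp ns that by (auto simp: final_pos_def mover_disp_def new_disp_def)
  have lastin: "?u \<in> set xs" using assms by simp
  have cf: "collision_free ?S a {?u} d"
    unfolding collision_free_def fst_path_shape
  proof (intro ballI impI allI)
    fix m m' and t :: real
    assume m: "m \<in> Inl ` set xs \<union> Inr ` {?u}" "m' \<in> Inl ` set xs \<union> Inr ` {?u}" "m \<noteq> m'"
    have "mover_start ?S a d m \<noteq> mover_start ?S a d m'"
      using m assms st by auto
    then show "traj ?S a {?u} d m t \<noteq> traj ?S a {?u} d m' t"
      using md m by (auto simp: traj_def Let_def prod_eq_iff)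
  qed
  have old_edges: "{{final_pos ?S a {?u} d (Inl x), final_pos ?S a {?u} d (Inl y)} | x y. {x, y} \<in> snd ?S \<and>
      \<not> (\<exists>z \<in> {?u}. is_split ?S d z \<and> {x, y} = {z, z + d})} = snd ?S" (is "?L = ?R")
  proof
    show "?L \<subseteq> ?R"
    proof
      fix e assume "e \<in> ?L"
      then obtain x y where e: "e = {final_pos ?S a {?u} d (Inl x), final_pos ?S a {?u} d (Inl y)}"
        "{x, y} \<in> snd ?S" by blast
      then obtain i where "{x, y} = {xs ! i, xs ! Suc i}" "Suc i < length xs"
        unfolding path_shape_def snd_conv by blast
      then have "x \<in> set xs" "y \<in> set xs" by (metis Suc_lessD doubleton_eq_iff nth_mem)+
      then show "e \<in> ?R" using e fin by simp
    qed
    show "?R \<subseteq> ?L"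
    proof
      fix e assume e: "e \<in> ?R"
      then obtain i where i: "e = {xs ! i, xs ! Suc i}" "Suc i < length xs"
        unfolding path_shape_def snd_conv by blast
      then have "e = {final_pos ?S a {?u} d (Inl (xs ! i)), final_pos ?S a {?u} d (Inl (xs ! Suc i))}"
        using fin by simp
      moreover have "{xs ! i, xs ! Suc i} \<in> snd ?S" using e i(1) by simp
      moreover have "\<not> (\<exists>z \<in> {?u}. is_split ?S d z \<and> {xs ! i, xs ! Suc i} = {z, z + d})" using ns by simp
      ultimately show "e \<in> ?L" by blast
    qed
  qed
  have edges: "snd (path_shape (xs @ [?u + d])) = insert {?u, ?u + d} (snd ?S)"
  proof -
    obtain m where m: "length xs = Suc m" using assms(2) by (cases xs) auto
    have "{{(xs @ [?u + d]) ! i, (xs @ [?u + d]) ! Suc i} | i. Suc i < Suc (Suc m)}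
      = insert {?u, ?u + d} {{xs ! i, xs ! Suc i} | i. Suc i < Suc m}" (is "?L = ?R")
    proof
      show "?L \<subseteq> ?R"
      proof
        fix e assume "e \<in> ?L"
        then obtain i where i: "e = {(xs @ [?u + d]) ! i, (xs @ [?u + d]) ! Suc i}" "i \<le> m" by auto
        show "e \<in> ?R"
        proof (cases "i = m")
          case True
          then show ?thesis using i m assms(2) by (auto simp: nth_append last_conv_nth)
        next
          case False
          then show ?thesis using i m by (auto simp: nth_append intro!: exI[of _ i])
        qed
      qed
      show "?R \<subseteq> ?L"
      proof
        fix e assume "e \<in> ?R"
        then consider "e = {?u, ?u + d}" | i where "e = {xs ! i, xs ! Suc i}" "i < m" by auto
        then show "e \<in> ?L"
        proof cases
          case 1
          then show ?thesis using m assms(2)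
            by (auto simp: nth_append last_conv_nth intro!: exI[of _ m])
        next
          case (2 i)
          then show ?thesis using m by (auto simp: nth_append intro!: exI[of _ i])
        qed
      qed
    qed
    then show ?thesis by (simp add: path_shape_def m)
  qed
  have "step_result ?S a {?u} d = (insert (?u + d) (set xs), insert {?u, ?u + d} (snd ?S))"
  proof -
    have "final_pos ?S a {?u} d ` (Inl ` set xs \<union> Inr ` {?u}) = insert (?u + d) (set xs)"
      unfolding image_Un image_image using fin lastin by simp
    moreover have "{{final_pos ?S a {?u} d (Inl z), final_pos ?S a {?u} d (Inr z)} | z. z \<in> {?u}} = {{?u, ?u + d}}"
    proof -
      have one: "{g z | z. z \<in> {?u}} = {g ?u}" for g :: "pt \<Rightarrow> pt set" by blast
      show ?thesis unfolding one fin[OF lastin] ..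
    qed
    moreover have "{{final_pos ?S a {?u} d (Inr z), final_pos ?S a {?u} d (Inl (z + d))} | z.
        z \<in> {?u} \<and> is_split ?S d z} = {}"
      using ns by blast
    ultimately show ?thesis
      unfolding step_result_def Let_def fst_path_shape old_edges by (simp only: Un_insert_right Un_empty_right)
  qed
  also have "\<dots> = path_shape (xs @ [?u + d])"
    using edges by (simp add: prod_eq_iff)
  finally show ?thesis
    unfolding valid_step_def using cf lastin assms(3)
    by (metis empty_subsetI fst_path_shape insert_subset)
qed

section \<open>Splitting a set of parallel edges\<close>

text \<open>A path with a set of edges selected for splitting is given by its list of steps, each paired
with a flag. The movers of the resulting step are listed in path order as triples of the mover, its
start and its final point.\<close>

definition split_word :: "(pt \<times> bool) list \<Rightarrow> pt list" where
  "split_word bs = concat (map (\<lambda>(w, b). if b then [w, w] else [w]) bs)"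

fun split_movers :: "pt \<Rightarrow> pt \<Rightarrow> pt \<Rightarrow> (pt \<times> bool) list \<Rightarrow> ((pt + pt) \<times> pt \<times> pt) list" where
  "split_movers d p q [] = [(Inl p, p, q)]"
| "split_movers d p q ((w, b) # bs) =
     (if b then (Inl p, p, q) # (Inr (if w = d then p else p + w), p + w, q + w)
                  # split_movers d (p + w) (q + w + w) bs
      else (Inl p, p, q) # split_movers d (p + w) (q + w) bs)"

definition old_pos :: "pt \<Rightarrow> (pt \<times> bool) list \<Rightarrow> nat \<Rightarrow> pt" where
  "old_pos p bs j = p + sum_list (map fst (take j bs))"

definition new_pos :: "pt \<Rightarrow> (pt \<times> bool) list \<Rightarrow> nat \<Rightarrow> pt" where
  "new_pos q bs j = q + sum_list (map (\<lambda>(w, b). if b then w + w else w) (take j bs))"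

text \<open>All operations of a step point in direction \<open>d\<close>. So an edge running along
  \<open>d\<close> is split from its earlier end, and one running along \<open>- d\<close> from its
  later end.\<close>

definition split_node :: "pt \<Rightarrow> pt \<Rightarrow> (pt \<times> bool) list \<Rightarrow> nat \<Rightarrow> pt" where
  "split_node d p bs i = (if fst (bs ! i) = d then old_pos p bs i else old_pos p bs (Suc i))"

definition split_idx :: "(pt \<times> bool) list \<Rightarrow> nat set" where
  "split_idx bs = {i. i < length bs \<and> snd (bs ! i)}"

lemma old_pos_0 [simp]: "old_pos p bs 0 = p"
  by (simp add: old_pos_def)

lemma new_pos_0 [simp]: "new_pos p bs 0 = p"
  by (simp add: new_pos_def)

lemma old_pos_Cons [simp]: "old_pos p ((w, b) # bs) (Suc j) = old_pos (p + w) bs j"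
  by (simp add: old_pos_def add.assoc)

lemma new_pos_Cons [simp]:
  "new_pos p ((w, b) # bs) (Suc j) = new_pos (if b then p + w + w else p + w) bs j"
  by (simp add: new_pos_def add.assoc)

lemma old_pos_Suc: "j < length bs \<Longrightarrow> old_pos p bs (Suc j) = old_pos p bs j + fst (bs ! j)"
  by (simp add: old_pos_def take_Suc_conv_app_nth add.assoc)

lemma new_pos_Suc: "j < length bs \<Longrightarrow> new_pos p bs (Suc j)
    = new_pos p bs j + (if snd (bs ! j) then fst (bs ! j) + fst (bs ! j) else fst (bs ! j))"
  by (simp add: new_pos_def take_Suc_conv_app_nth add.assoc split: prod.split)

lemma nth_pts_old: "j \<le> length bs \<Longrightarrow> pts p (map fst bs) ! j = old_pos p bs j"
  by (simp add: nth_pts old_pos_def take_map)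

lemma split_node_Cons [simp]:
  "split_node d p ((w, b) # bs) (Suc i) = split_node d (p + w) bs i"
  "split_node d p ((w, b) # bs) 0 = (if w = d then p else p + w)"
  by (simp_all add: split_node_def)

lemma split_idx_Cons: "split_idx ((w, b) # bs) = (if b then {0} else {}) \<union> Suc ` split_idx bs"
proof (rule set_eqI)
  fix i show "i \<in> split_idx ((w, b) # bs) \<longleftrightarrow> i \<in> (if b then {0} else {}) \<union> Suc ` split_idx bs"
    by (cases i) (auto simp: split_idx_def)
qed

lemma atMost_Suc_image: "{..Suc n} = insert 0 (Suc ` {..n})"
  by (auto simp: image_iff) (metis atMost_iff Suc_le_mono not0_implies_Suc)

lemma lessThan_Suc_image: "{..<Suc n} = insert 0 (Suc ` {..<n})"
  by (auto simp: image_iff) (metis lessThan_iff Suc_less_eq not0_implies_Suc)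

lemma set_split_movers:
  "set (split_movers d p q bs) =
    (\<lambda>j. (Inl (old_pos p bs j), old_pos p bs j, new_pos q bs j)) ` {..length bs}
    \<union> (\<lambda>i. (Inr (split_node d p bs i), old_pos p bs (Suc i), new_pos q bs i + fst (bs ! i))) ` split_idx bs"
proof (induction bs arbitrary: p q)
  case Nil
  then show ?case by (simp add: split_idx_def)
next
  case (Cons x bs)
  obtain w b where x: "x = (w, b)" by (cases x)
  show ?case
    unfolding x split_movers.simps length_Cons atMost_Suc_image split_idx_Cons
    by (auto simp: Cons image_Un image_image)
qed

lemma map_split_movers: "map (snd \<circ> snd) (split_movers d p q bs) = pts q (split_word bs)"
proof (induction bs arbitrary: p q)
  case (Cons x bs)
  then show ?case by (cases x) (auto simp: split_word_def)
qed (simp add: split_word_def)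

text \<open>The three sets are the unsplit edges and the first and second halves of the split ones,
  in a form that can be compared with the edges of \<open>step_result\<close>.\<close>

lemma edges_split_word:
  "snd (path_shape (pts q (split_word bs))) =
     (\<lambda>i. {new_pos q bs i, new_pos q bs (Suc i)}) ` ({..<length bs} - split_idx bs)
     \<union> (\<lambda>i. {new_pos q bs i, new_pos q bs i + fst (bs ! i)}) ` split_idx bs
     \<union> (\<lambda>i. {new_pos q bs i + fst (bs ! i), new_pos q bs (Suc i)}) ` split_idx bs"
proof (induction bs arbitrary: q)
  case Nil
  then show ?case by (simp add: split_idx_def path_shape_def split_word_def)
next
  case (Cons x bs)
  obtain w b where x: "x = (w, b)" by (cases x)
  have hd: "pts r ws = r # tl (pts r ws)" for r ws
    by (cases ws) auto
  have sh: "snd (path_shape (q # pts r ws)) = insert {q, r} (snd (path_shape (pts r ws)))" for q r ws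
    by (subst hd, subst path_shape_Cons) (simp add: hd[symmetric])
  have d1: "insert 0 (Suc ` A) - insert 0 (Suc ` B) = Suc ` (A - B)"
    "insert 0 (Suc ` A) - Suc ` B = insert 0 (Suc ` (A - B))" for A B :: "nat set"
    by auto
  show ?case
  proof (cases b)
    case True
    then have "split_word (x # bs) = w # w # split_word bs" by (simp add: x split_word_def)
    then have "snd (path_shape (pts q (split_word (x # bs))))
      = insert {q, q + w} (insert {q + w, q + w + w} (snd (path_shape (pts (q + w + w) (split_word bs)))))"
      using sh[of q "q + w" "w # split_word bs"] sh[of "q + w" "q + w + w" "split_word bs"] by simp
    then show ?thesis
      unfolding Cons x length_Cons split_idx_Cons lessThan_Suc_image
      using True by (simp add: d1 image_image) blast
  next
    case False
    then have "split_word (x # bs) = w # split_word bs" by (simp add: x split_word_def)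
    then have "snd (path_shape (pts q (split_word (x # bs))))
      = insert {q, q + w} (snd (path_shape (pts (q + w) (split_word bs))))"
      using sh[of q "q + w" "split_word bs"] by simp
    then show ?thesis
      unfolding Cons x length_Cons split_idx_Cons lessThan_Suc_image
      using False by (simp add: d1 image_image)
  qed
qed

lemma sorted_wrt_sym_set:
  assumes "sorted_wrt R L" "\<And>x y. R x y \<Longrightarrow> R y x" "x \<in> set L" "y \<in> set L" "x \<noteq> y"
  shows "R x y"
proof -
  obtain i j where "i < length L" "j < length L" "x = L ! i" "y = L ! j" "i \<noteq> j"
    using assms by (metis in_set_conv_nth)
  then show ?thesis
    using sorted_wrt_nth_less[OF assms(1)] assms(2) by (metis nat_neq_iff)
qed

text \<open>The anchor is the first node, so distance to it is the index and the later end of each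
  selected edge is the farther one. A split thus pushes everything behind it along the direction in
  which the path runs, which amounts to doubling a letter of the word.\<close>

lemma valid_step_split:
  assumes dist: "distinct (pts p (map fst bs))" and d: "d \<in> cardinal_dirs"
    and par: "\<And>w. (w, True) \<in> set bs \<Longrightarrow> w = d \<or> w = - d"
    and sep: "sorted_wrt (\<lambda>m m'. separated (snd m) (snd m')) (split_movers d p p bs)"
  shows "valid_step (path_shape (pts p (map fst bs))) p (path_shape (pts p (split_word bs)))"
proof -
  define xs where "xs = pts p (map fst bs)"
  define n where "n = length bs"
  define P where "P = old_pos p bs"
  define Q where "Q = new_pos p bs"
  define K where "K = split_idx bs"
  define w where "w i = fst (bs ! i)" for i
  define u where "u = split_node d p bs"
  let ?S = "path_shape xs"
  have lxs: "length xs = Suc n" by (simp add: xs_def n_def)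
  have xsP: "xs ! j = P j" if "j \<le> n" for j
    using that by (simp add: xs_def n_def P_def nth_pts_old)
  have setxs: "set xs = P ` {..n}"
  proof -
    have "set xs = (!) xs ` {..n}"
      by (auto simp: set_conv_nth lxs less_Suc_eq_le)
    also have "\<dots> = P ` {..n}" using xsP by (intro image_cong) auto
    finally show ?thesis .
  qed
  have E: "snd ?S = (\<lambda>i. {P i, P (Suc i)}) ` {..<n}"
  proof -
    have "snd ?S = (\<lambda>i. {xs ! i, xs ! Suc i}) ` {..<n}"
      by (auto simp: path_shape_def lxs)
    also have "\<dots> = (\<lambda>i. {P i, P (Suc i)}) ` {..<n}" using xsP by (intro image_cong) auto
    finally show ?thesis .
  qed
  have P0: "xs ! 0 = p" using xsP[of 0] by (simp add: P_def)
  have inj: "P i = P j \<longleftrightarrow> i = j" if "i \<le> n" "j \<le> n" for i j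
    using dist that xsP lxs unfolding xs_def[symmetric] by (metis le_imp_less_Suc nth_eq_iff_index_eq)
  have dxs: "distinct xs" using dist by (simp add: xs_def)
  have Kn: "i < n" if "i \<in> K" for i using that by (simp add: K_def split_idx_def n_def)
  have finK: "finite K" using Kn by (meson finite_lessThan finite_subset lessThan_iff subsetI)
  have PS: "P (Suc i) = P i + w i" if "i < n" for i
    using that by (simp add: P_def n_def w_def old_pos_Suc)
  have QS: "Q (Suc i) = Q i + (if i \<in> K then w i + w i else w i)" if "i < n" for i
    using that by (simp add: Q_def n_def w_def K_def split_idx_def new_pos_Suc)
  have wK: "w i = d \<or> w i = - d" if "i \<in> K" for i
  proof -
    have "(w i, True) \<in> set bs"
      using that unfolding K_def split_idx_def w_def by (metis (mono_tags) mem_Collect_eq nth_mem prod.collapse)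
    then show ?thesis using par by blast
  qed
  have d0: "d \<noteq> - d" using d by (auto simp: cardinal_dirs_def)
  have ue: "u i = P i \<and> u i + d = P (Suc i) \<or> u i = P (Suc i) \<and> u i + d = P i" if "i \<in> K" for i
    using wK[OF that] PS[OF Kn[OF that]] d0
    unfolding u_def split_node_def P_def[symmetric] w_def[symmetric] by auto
  have uset: "{u i, u i + d} = {P i, P (Suc i)}" if "i \<in> K" for i
    using ue[OF that] by auto
  have edge_eq: "{P i, P (Suc i)} = {P k, P (Suc k)} \<longleftrightarrow> i = k" if "i < n" "k < n" for i k
    using path_edge_eq_iff[OF dxs, of i k] that lxs xsP by simp
  have uinj: "inj_on u K"
  proof (rule inj_onI)
    fix i k assume "i \<in> K" "k \<in> K" "u i = u k"
    then have "{P i, P (Suc i)} = {P k, P (Suc k)}" using uset by metis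
    then show "i = k" using edge_eq Kn \<open>i \<in> K\<close> \<open>k \<in> K\<close> by blast
  qed
  have split: "is_split ?S d (u i)" if "i \<in> K" for i
    unfolding is_split_def uset[OF that] E using Kn[OF that] by blast
  have gd: "gdist (snd ?S) p (P j) = j" if "j \<le> n" for j
    using gdist_path[OF dxs, of j] that lxs xsP P0 by simp
  have far: "far_end ?S p d (u i) = P (Suc i)" "near_end ?S p d (u i) = P i" if "i \<in> K" for i
    using ue[OF that] gd[of i] gd[of "Suc i"] Kn[OF that] unfolding far_end_def near_end_def by auto
  have contr: "contrib ?S p d (u i) = w i" if "i \<in> K" for i
    unfolding contrib_def far[OF that] PS[OF Kn[OF that]] by simp
  have hang: "P j \<in> hanging ?S p (P i) \<longleftrightarrow> i \<le> j" if "i \<le> n" "j \<le> n" for i j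
    using hanging_path[OF dxs, of i j] that lxs xsP P0 by simp
  define Ops where "Ops = u ` K"
  have disp: "disp ?S p Ops d (P j) = Q j - P j" if "j \<le> n" for j
  proof -
    \<comment> \<open>The far end of edge \<open>i\<close> is \<open>P (Suc i)\<close>, and
      \<open>P j\<close> hangs from it exactly if \<open>i < j\<close>.\<close>
    have "{x \<in> Ops. is_split ?S d x \<and> P j \<in> hanging ?S p (far_end ?S p d x)} = u ` {i \<in> K. i < j}"
      unfolding Ops_def using split far hang Kn that by (auto simp: Suc_le_eq)
    then have "disp ?S p Ops d (P j) = (\<Sum>x \<in> u ` {i \<in> K. i < j}. contrib ?S p d x)"
      by (simp add: disp_def)
    also have "\<dots> = (\<Sum>i \<in> {i \<in> K. i < j}. w i)"
      using uinj contr by (subst sum.reindex) (auto simp: inj_on_def intro!: sum.cong)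
    \<comment> \<open>Passing from \<open>j\<close> to \<open>Suc j\<close> changes both sides by
      \<open>w j\<close> if edge \<open>j\<close> is selected, and by nothing otherwise.\<close>
    also have "\<dots> = Q j - P j"
      using that
    proof (induction j)
      case 0
      then show ?case by (simp add: P_def Q_def)
    next
      case (Suc j)
      have "{i \<in> K. i < Suc j} = (if j \<in> K then insert j {i \<in> K. i < j} else {i \<in> K. i < j})"
        by (auto simp: less_Suc_eq)
      then show ?case using Suc finK PS[of j] QS[of j] by (simp add: algebra_simps)
    qed
    finally show ?thesis .
  qed
  have st: "mover_start ?S p d (Inl y) = y" for y by (simp add: mover_start_def)
  have st': "mover_start ?S p d (Inr (u i)) = P (Suc i)" if "i \<in> K" for i
    using split[OF that] far[OF that] by (simp add: mover_start_def new_start_def)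
  have fin: "final_pos ?S p Ops d (Inl (P j)) = Q j" if "j \<le> n" for j
    using disp[OF that] by (simp add: final_pos_def mover_disp_def st)
  have fin': "final_pos ?S p Ops d (Inr (u i)) = Q i + w i" if "i \<in> K" for i
    using split[OF that] far[OF that] disp[of i] Kn[OF that] PS[OF Kn[OF that]]
    by (simp add: final_pos_def mover_disp_def new_disp_def st' that)
  define L where "L = split_movers d p p bs"
  have setL: "set L = (\<lambda>j. (Inl (P j), P j, Q j)) ` {..n} \<union> (\<lambda>i. (Inr (u i), P (Suc i), Q i + w i)) ` K"
    unfolding L_def set_split_movers P_def Q_def K_def u_def w_def n_def ..
  have mov: "(m, mover_start ?S p d m, final_pos ?S p Ops d m) \<in> set L"
    if "m \<in> Inl ` set xs \<union> Inr ` Ops" for m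
  proof -
    from that consider j where "m = Inl (P j)" "j \<le> n" | i where "m = Inr (u i)" "i \<in> K"
      unfolding setxs Ops_def by blast
    then show ?thesis
    proof cases
      case 1
      then show ?thesis unfolding setL by (simp add: st fin)
    next
      case 2
      then show ?thesis unfolding setL by (simp add: st' fin')
    qed
  qed
  have cf: "collision_free ?S p Ops d"
    unfolding collision_free_def fst_path_shape
  proof (intro ballI impI allI)
    fix m m' and t :: real
    assume m: "m \<in> Inl ` set xs \<union> Inr ` Ops" "m' \<in> Inl ` set xs \<union> Inr ` Ops" "m \<noteq> m'" and t: "0 < t \<and> t \<le> 1"
    have "separated (snd (m, mover_start ?S p d m, final_pos ?S p Ops d m))
      (snd (m', mover_start ?S p d m', final_pos ?S p Ops d m'))"
      using sorted_wrt_sym_set[OF sep[folded L_def] _ mov[OF m(1)] mov[OF m(2)]] m(3) separated_sym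
      by blast
    then show "traj ?S p Ops d m t \<noteq> traj ?S p Ops d m' t"
      using traj_neq_if_separated t by simp
  qed
  have nodes: "final_pos ?S p Ops d ` (Inl ` set xs \<union> Inr ` Ops) = set (pts p (split_word bs))"
  proof -
    have "final_pos ?S p Ops d ` (Inl ` set xs \<union> Inr ` Ops) = Q ` {..n} \<union> (\<lambda>i. Q i + w i) ` K"
      unfolding setxs Ops_def image_Un image_image
      by (intro arg_cong2[of _ _ _ _ "(\<union>)"] image_cong) (auto simp: fin[unfolded Ops_def] fin'[unfolded Ops_def])
    also have "\<dots> = (snd \<circ> snd) ` set L"
      unfolding setL by (simp add: image_Un image_image)
    also have "\<dots> = set (pts p (split_word bs))"
      by (metis L_def map_split_movers set_map)
    finally show ?thesis .
  qed
  have ed1: "{{final_pos ?S p Ops d (Inl x), final_pos ?S p Ops d (Inl y)} | x y. {x, y} \<in> snd ?S \<and>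
            \<not> (\<exists>z \<in> Ops. is_split ?S d z \<and> {x, y} = {z, z + d})}
      = (\<lambda>i. {Q i, Q (Suc i)}) ` ({..<n} - K)" (is "?L = ?R")
  proof
    show "?L \<subseteq> ?R"
    proof
      fix e assume "e \<in> ?L"
      then obtain x y where xy: "e = {final_pos ?S p Ops d (Inl x), final_pos ?S p Ops d (Inl y)}"
        "{x, y} \<in> snd ?S" "\<not> (\<exists>z \<in> Ops. is_split ?S d z \<and> {x, y} = {z, z + d})" by blast
      obtain i where i: "i < n" "{x, y} = {P i, P (Suc i)}" using xy(2) E by auto
      have "i \<notin> K"
      proof
        assume k: "i \<in> K"
        then have "u i \<in> Ops" "is_split ?S d (u i)" "{x, y} = {u i, u i + d}"
          using i(2) uset split by (auto simp: Ops_def)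
        then show False using xy(3) by blast
      qed
      moreover have "e = {Q i, Q (Suc i)}"
        using i xy(1) fin[of i] fin[of "Suc i"] by (auto simp: doubleton_eq_iff)
      ultimately show "e \<in> ?R" using i by blast
    qed
    show "?R \<subseteq> ?L"
    proof
      fix e assume "e \<in> ?R"
      then obtain i where i: "i < n" "i \<notin> K" "e = {Q i, Q (Suc i)}" by auto
      have "{P i, P (Suc i)} \<noteq> {z, z + d}" if z: "z \<in> Ops" for z
      proof -
        obtain k where k: "k \<in> K" "z = u k" using z by (auto simp: Ops_def)
        show ?thesis unfolding k(2) uset[OF k(1)] using edge_eq[OF i(1) Kn[OF k(1)]] i k by auto
      qed
      moreover have "{P i, P (Suc i)} \<in> snd ?S" using E i by blast
      moreover have "e = {final_pos ?S p Ops d (Inl (P i)), final_pos ?S p Ops d (Inl (P (Suc i)))}"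
        using i fin[of i] fin[of "Suc i"] by simp
      ultimately show "e \<in> ?L" by blast
    qed
  qed
  have ed2: "{{final_pos ?S p Ops d (Inl z), final_pos ?S p Ops d (Inr z)} | z. z \<in> Ops}
      \<union> {{final_pos ?S p Ops d (Inr z), final_pos ?S p Ops d (Inl (z + d))} | z. z \<in> Ops \<and> is_split ?S d z}
      = (\<lambda>i. {Q i, Q i + w i}) ` K \<union> (\<lambda>i. {Q i + w i, Q (Suc i)}) ` K"
  proof -
    \<comment> \<open>Which half of a split edge is attached to the operated node depends on the
      orientation of the edge, so the two halves are compared together as a set for each
      \<open>i\<close>.\<close>
    have pr: "{{final_pos ?S p Ops d (Inl (u i)), final_pos ?S p Ops d (Inr (u i))},
         {final_pos ?S p Ops d (Inr (u i)), final_pos ?S p Ops d (Inl (u i + d))}}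
      = {{Q i, Q i + w i}, {Q i + w i, Q (Suc i)}}" if "i \<in> K" for i
    proof -
      have f: "final_pos ?S p Ops d (Inl (P i)) = Q i" "final_pos ?S p Ops d (Inl (P (Suc i))) = Q (Suc i)"
        using fin Kn[OF that] by auto
      have swap: "{{z, y}, {y, x}} = {{x, y}, {y, z}}" for x y z :: pt by blast
      from ue[OF that] show ?thesis
      proof (elim disjE conjE)
        assume "u i = P i" "u i + d = P (Suc i)"
        then show ?thesis using fin'[OF that] f by simp
      next
        assume "u i = P (Suc i)" "u i + d = P i"
        then show ?thesis using fin'[OF that] f swap by simp
      qed
    qed
    have "?thesis \<longleftrightarrow> (\<Union>i\<in>K. {{final_pos ?S p Ops d (Inl (u i)), final_pos ?S p Ops d (Inr (u i))},
         {final_pos ?S p Ops d (Inr (u i)), final_pos ?S p Ops d (Inl (u i + d))}})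
      = (\<Union>i\<in>K. {{Q i, Q i + w i}, {Q i + w i, Q (Suc i)}})"
    proof -
      have 1: "{{final_pos ?S p Ops d (Inl z), final_pos ?S p Ops d (Inr z)} | z. z \<in> Ops}
      \<union> {{final_pos ?S p Ops d (Inr z), final_pos ?S p Ops d (Inl (z + d))} | z. z \<in> Ops \<and> is_split ?S d z}
      = (\<Union>i\<in>K. {{final_pos ?S p Ops d (Inl (u i)), final_pos ?S p Ops d (Inr (u i))},
         {final_pos ?S p Ops d (Inr (u i)), final_pos ?S p Ops d (Inl (u i + d))}})"
        unfolding Ops_def using split by blast
      have 2: "(\<lambda>i. {Q i, Q i + w i}) ` K \<union> (\<lambda>i. {Q i + w i, Q (Suc i)}) ` K
        = (\<Union>i\<in>K. {{Q i, Q i + w i}, {Q i + w i, Q (Suc i)}})" by blast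
      show ?thesis unfolding 1 2 ..
    qed
    then show ?thesis using pr by simp
  qed
  have "step_result ?S p Ops d = path_shape (pts p (split_word bs))"
    unfolding step_result_def Let_def fst_path_shape nodes Un_assoc ed1 ed2
    by (simp add: prod_eq_iff edges_split_word Q_def n_def K_def w_def Un_assoc)
  moreover have "Ops \<subseteq> set xs"
  proof
    fix x assume "x \<in> Ops"
    then obtain i where "i \<in> K" "x = u i" by (auto simp: Ops_def)
    then show "x \<in> set xs" using ue[of i] Kn[of i] setxs by auto
  qed
  ultimately show ?thesis
    unfolding valid_step_def xs_def[symmetric] using cf d
    by (metis fst_path_shape)
qed

section \<open>Spirals as lists of segment lengths\<close>

lemma rot_cardinal:
  assumes "rot \<in> {rot_ccw, rot_cw}" "d \<in> cardinal_dirs"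
  shows "rot d \<in> cardinal_dirs" "rot (rot d) = - d" "dot d d = 1" "dot (rot d) d = 0"
    "dot d (rot d) = 0"
  using assms by (auto simp: cardinal_dirs_def rot_ccw_def rot_cw_def dot_def)

fun spiral_word :: "(pt \<Rightarrow> pt) \<Rightarrow> pt \<Rightarrow> nat list \<Rightarrow> pt list" where
  "spiral_word rot d [] = []"
| "spiral_word rot d (a # as) = replicate a d @ spiral_word rot (rot d) as"

definition scale :: "nat \<Rightarrow> pt \<Rightarrow> pt" where
  "scale n d = (int n * fst d, int n * snd d)"

lemma scale_0 [simp]: "scale 0 d = 0"
  by (simp add: scale_def zero_prod_def)

lemma scale_Suc: "scale (Suc n) d = d + scale n d"
  by (simp add: scale_def prod_eq_iff algebra_simps)

lemma scale_add: "scale (m + n) d = scale m d + scale n d"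
  by (simp add: scale_def prod_eq_iff algebra_simps)

lemma scale_uminus: "scale n (- d) = - scale n d"
  by (simp add: scale_def prod_eq_iff)

lemma sum_list_replicate_scale [simp]: "sum_list (replicate n d) = scale n d"
  by (induction n) (auto simp: scale_Suc)

lemma dot_scale [simp]: "dot v (scale n d) = int n * dot v d"
  by (simp add: scale_def dot_def algebra_simps)

lemma set_pts_replicate: "set (pts p (replicate n d)) = (\<lambda>i. p + scale i d) ` {..n}"
proof (induction n arbitrary: p)
  case (Suc n)
  show ?case unfolding atMost_Suc_image
    by (simp add: Suc image_image scale_Suc add.assoc)
qed simp

section \<open>Nested lists and the region covered by their spirals\<close>

fun nested :: "nat list \<Rightarrow> bool" where
  "nested (a # b # c # as) \<longleftrightarrow> c < a \<and> nested (b # c # as)"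
| "nested _ \<longleftrightarrow> True"

lemma nested_tl: "nested (a # as) \<Longrightarrow> nested as"
  by (cases as rule: nested.cases) auto

text \<open>With the default \<open>0\<close>, a missing segment imposes no condition and has no
  extent, so short lists need no separate treatment.\<close>

definition nth0 :: "nat list \<Rightarrow> nat \<Rightarrow> nat" where
  "nth0 as i = (if i < length as then as ! i else 0)"

lemma nth0_simps [simp]: "nth0 (a # as) 0 = a" "nth0 (a # as) (Suc i) = nth0 as i" "nth0 [] i = 0"
  by (auto simp: nth0_def)

lemma nested_Cons_iff:
  assumes "0 < a"
  shows "nested (a # as) \<longleftrightarrow> nth0 as 1 < a \<and> nested as"
  using assms by (cases as rule: nested.cases) auto

text \<open>The first two segments span a rectangle containing everything. By induction the tail
  lies in the rectangle spanned by the second and third segments, and the third goes back by less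
  than the length of the first, hence stays strictly ahead of the start.\<close>

lemma nested_spiral_box:
  assumes rot: "rot \<in> {rot_ccw, rot_cw}" and "d \<in> cardinal_dirs" "nested as" "0 \<notin> set as"
    and "x \<in> set (pts p (spiral_word rot d as))"
  shows "0 \<le> dot d (x - p) \<and> dot d (x - p) \<le> nth0 as 0 \<and>
    0 \<le> dot (rot d) (x - p) \<and> dot (rot d) (x - p) \<le> nth0 as 1 \<and> (x = p \<or> 0 < dot d (x - p))"
  using assms(2-)
proof (induction as arbitrary: d p)
  case Nil
  then show ?case by (simp add: dot_def)
next
  case (Cons a as)
  note r = rot_cardinal[OF rot Cons.prems(1)]
  let ?q = "p + scale a d"
  have nest: "nth0 as 1 < a" "nested as" using Cons.prems nested_Cons_iff by auto
  have "x \<in> set (pts p (replicate a d)) \<or> x \<in> set (pts ?q (spiral_word rot (rot d) as))"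
    using Cons.prems(4) by (auto simp: pts_append dest: list.set_sel(2)[rotated])
  then show ?case
  proof
    assume "x \<in> set (pts p (replicate a d))"
    then obtain i where "i \<le> a" "x = p + scale i d" by (auto simp: set_pts_replicate)
    then show ?thesis using r by (cases "i = 0") auto
  next
    assume "x \<in> set (pts ?q (spiral_word rot (rot d) as))"
    from Cons.IH[OF r(1) nest(2) _ this] Cons.prems(3) show ?thesis
      using nest r by auto
  qed
qed

text \<open>The rectangle alone does not exclude a return to \<open>p\<close>. There is none: the
  first segment moves away from \<open>p\<close>, and what follows its end goes back by at most the
  third length, which is less than the first.\<close>

lemma nested_spiral_halfplane:
  assumes "rot \<in> {rot_ccw, rot_cw}" "d \<in> cardinal_dirs" "nested as" "0 \<notin> set as"
    and "x \<in> set (tl (pts p (spiral_word rot d as)))"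
  shows "dot d p < dot d x"
proof (cases as)
  case Nil
  then show ?thesis using assms by simp
next
  case (Cons a bs)
  then obtain a' where a: "a = Suc a'" using assms(4) by (cases a) auto
  let ?q = "p + d"
  note r = rot_cardinal[OF assms(1,2)]
  show ?thesis
  proof -
    have "x \<in> set (pts p (spiral_word rot d as))"
      using assms(5) by (metis list.set_sel(2) pts_neq_Nil)
    from nested_spiral_box[OF assms(1-4) this] have "x = p \<or> 0 < dot d (x - p)" by blast
    moreover have "x \<noteq> p"
    proof
      assume "x = p"
      then have p: "p \<in> set (pts ?q (replicate a' d @ spiral_word rot (rot d) bs))"
        using assms(5) Cons a by simp
      have "p \<in> set (pts ?q (replicate a' d)) \<or> p \<in> set (pts (?q + scale a' d) (spiral_word rot (rot d) bs))"
        using p by (auto simp: pts_append dest: list.set_sel(2)[rotated])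
      then show False
      proof
        assume "p \<in> set (pts ?q (replicate a' d))"
        then obtain i where "p = ?q + scale i d" by (auto simp: set_pts_replicate)
        then have "dot d p = dot d (?q + scale i d)" by (rule arg_cong)
        then show False using r by simp
      next
        assume *: "p \<in> set (pts (?q + scale a' d) (spiral_word rot (rot d) bs))"
        have n: "nested bs" "nth0 bs 1 < a" "0 \<notin> set bs"
          using assms Cons nested_Cons_iff by auto
        from nested_spiral_box[OF assms(1) r(1) n(1,3) *]
        have "dot (rot (rot d)) (p - (?q + scale a' d)) \<le> nth0 bs 1" by blast
        then show False using n(2) r a by simp
      qed
    qed
    ultimately show ?thesis by simp
  qed
qed

section \<open>Stretching the segments of a spiral\<close>

text \<open>Splitting \<open>a - a'\<close> of the \<open>a'\<close> edges yields length
  \<open>a\<close> and leaves \<open>2 * a' - a\<close> edges as they are; for lengths that are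
  \<open>stretchable\<close> neither difference is truncated.\<close>

definition stretch_seg :: "pt \<Rightarrow> nat \<Rightarrow> nat \<Rightarrow> (pt \<times> bool) list" where
  "stretch_seg d a' a = replicate (a - a') (d, True) @ replicate (2 * a' - a) (d, False)"

fun stretch :: "(pt \<Rightarrow> pt) \<Rightarrow> pt \<Rightarrow> nat list \<Rightarrow> nat list \<Rightarrow> (pt \<times> bool) list" where
  "stretch rot d (a' # as') (a # as) = stretch_seg d a' a @ stretch rot (rot d) as' as"
| "stretch rot d _ _ = []"

definition stretchable :: "nat \<Rightarrow> nat \<Rightarrow> bool" where
  "stretchable a' a \<longleftrightarrow> 0 < a' \<and> a' \<le> a \<and> a \<le> 2 * a'"

lemma stretch_seg_words:
  assumes "stretchable a' a"
  shows "map fst (stretch_seg d a' a) = replicate a' d" "split_word (stretch_seg d a' a) = replicate a d"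
proof -
  have sw: "split_word (replicate i (d, True)) = replicate (2 * i) d" 
    "split_word (replicate i (d, False)) = replicate i d" for i
    by (induction i) (auto simp: split_word_def)
  have "split_word (stretch_seg d a' a) = replicate (2 * (a - a')) d @ replicate (2 * a' - a) d"
    unfolding stretch_seg_def sw(1)[symmetric] sw(2)[of "2 * a' - a", symmetric]
    by (simp only: split_word_def map_append concat_append)
  moreover have "2 * (a - a') + (2 * a' - a) = a"
    using assms by (auto simp: stretchable_def)
  ultimately show "split_word (stretch_seg d a' a) = replicate a d"
    by (metis replicate_add)
  show "map fst (stretch_seg d a' a) = replicate a' d"
    using assms by (simp add: stretch_seg_def stretchable_def replicate_add[symmetric])
qed

lemma stretch_words:
  assumes "list_all2 stretchable as' as"
  shows "map fst (stretch rot d as' as) = spiral_word rot d as'"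
    "split_word (stretch rot d as' as) = spiral_word rot d as"
proof -
  have "map fst (stretch rot d as' as) = spiral_word rot d as' \<and>
    split_word (stretch rot d as' as) = spiral_word rot d as"
    using assms
  proof (induction as' as arbitrary: d rule: list_all2_induct)
    case Nil
    then show ?case by (simp add: split_word_def)
  next
    case (Cons a' as' a as)
    have "split_word (xs @ ys) = split_word xs @ split_word ys" for xs ys
      by (simp add: split_word_def)
    then show ?case using Cons stretch_seg_words by simp
  qed
  then show "map fst (stretch rot d as' as) = spiral_word rot d as'"
    "split_word (stretch rot d as' as) = spiral_word rot d as" by auto
qed

text \<open>The common node of the two parts is the last mover of the first and the first mover of
  the second, hence the \<open>butlast\<close>.\<close>

lemma split_movers_append:
  "split_movers e p q (bs @ cs) = butlast (split_movers e p q bs)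
     @ split_movers e (p + sum_list (map fst bs)) (q + sum_list (split_word bs)) cs"
proof (induction bs arbitrary: p q)
  case Nil
  then show ?case by (simp add: split_word_def)
next
  case (Cons x bs)
  have ne: "split_movers e p q bs \<noteq> []" for p q
    by (cases bs) (auto split: if_splits)
  show ?case by (cases x) (auto simp: Cons ne split_word_def add.assoc)
qed

lemma split_movers_hd: "split_movers e p q bs = (Inl p, p, q) # tl (split_movers e p q bs)"
proof (cases bs)
  case (Cons x xs)
  then show ?thesis by (cases x) auto
qed simp

text \<open>This carries half-plane bounds from paths over to movers. It covers new nodes too,
  because each starts at the later end of its edge and so never counts as the first node.\<close>

lemma split_movers_tl:
  assumes "m \<in> set (tl (split_movers e p q bs))"
  shows "fst (snd m) \<in> set (tl (pts p (map fst bs)))" "snd (snd m) \<in> set (tl (pts q (split_word bs)))"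
proof -
  have "snd (snd m) \<in> set (map (snd \<circ> snd) (tl (split_movers e p q bs)))"
    using assms by (metis comp_apply image_eqI list.set_map)
  then show "snd (snd m) \<in> set (tl (pts q (split_word bs)))"
    by (simp add: map_split_movers map_tl)
  show "fst (snd m) \<in> set (tl (pts p (map fst bs)))"
    using assms
  proof (induction bs arbitrary: p q)
    case (Cons x bs)
    obtain w b where x: "x = (w, b)" by (cases x)
    have p: "pts (p + w) (map fst bs) = (p + w) # tl (pts (p + w) (map fst bs))"
      by (cases bs) auto
    have IH: "m \<in> set (split_movers e (p + w) q' bs) \<Longrightarrow> fst (snd m) \<in> set (pts (p + w) (map fst bs))" for q'
      using Cons.IH[of "p + w" q'] p split_movers_hd[of e "p + w" q' bs]
      by (metis fst_conv insert_iff list.set(2) snd_conv)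
    have "p + w \<in> set (pts (p + w) (map fst bs))" by (metis p list.set_intros(1))
    moreover have "fst (snd m) = p + w \<or> m \<in> set (split_movers e (p + w) (q + w) bs)
        \<or> m \<in> set (split_movers e (p + w) (q + w + w) bs)"
      using Cons.prems unfolding x by (cases b) auto
    ultimately have "fst (snd m) \<in> set (pts (p + w) (map fst bs))" using IH by metis
    then show ?case by (simp add: x)
  qed simp
qed

text \<open>Along a straight segment the segment direction itself separates the movers.\<close>

lemma split_movers_straight:
  assumes "dot d d = 1" "dot v d = 0" "\<And>x. x \<in> set bs \<Longrightarrow> fst x = d"
  shows "sorted_wrt (\<lambda>m m'. separated (snd m) (snd m')) (split_movers e p q bs) \<and>
    (\<forall>m \<in> set (split_movers e p q bs). dot d p \<le> dot d (fst (snd m)) \<and> dot d q \<le> dot d (snd (snd m)) \<and>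
      dot v (fst (snd m)) = dot v p \<and> dot v (snd (snd m)) = dot v q)"
  using assms(3)
proof (induction bs arbitrary: p q)
  case (Cons x bs)
  obtain b where x: "x = (d, b)" using Cons.prems[of x] by (metis list.set_intros(1) prod.collapse)
  have bs: "\<And>y. y \<in> set bs \<Longrightarrow> fst y = d" using Cons.prems by simp
  show ?case
  proof (cases b)
    case True
    have "separated (p, q) (snd m)" "separated (p + d, q + d) (snd m)"
      if "m \<in> set (split_movers e (p + d) (q + d + d) bs)" for m
      using Cons.IH[OF bs, of "p + d" "q + d + d"] that assms(1)
      by (auto intro!: separatedI[of d])
    moreover have "separated (p, q) (p + d, q + d)"
      using assms(1) by (auto intro!: separatedI[of d])
    ultimately show ?thesis
      using Cons.IH[OF bs, of "p + d" "q + d + d"] assms True by (auto simp: x)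
  next
    case False
    have "separated (p, q) (snd m)"
      if "m \<in> set (split_movers e (p + d) (q + d) bs)" for m
      using Cons.IH[OF bs, of "p + d" "q + d"] that assms(1)
      by (auto intro!: separatedI[of d])
    then show ?thesis
      using Cons.IH[OF bs, of "p + d" "q + d"] assms False by (auto simp: x)
  qed
qed simp

lemma split_movers_last:
  "last (split_movers e p q bs) = (Inl (p + sum_list (map fst bs)), p + sum_list (map fst bs), q + sum_list (split_word bs))"
proof (induction bs arbitrary: p q)
  case (Cons x bs)
  have ne: "split_movers e p q bs \<noteq> []" for p q
    by (cases bs) (auto split: if_splits)
  show ?case by (cases x) (auto simp: Cons ne split_word_def add.assoc)
qed (simp add: split_word_def)

text \<open>An outer segment is separated from the rest of the spiral because the rest, apart from its
first node, lies strictly on one side of the line of the segment, both before and after.\<close>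

lemma stretch_separated:
  assumes rot: "rot \<in> {rot_ccw, rot_cw}" and "d \<in> cardinal_dirs"
    and "nested (tl as')" "nested (tl as)" "list_all2 stretchable as' as"
  shows "sorted_wrt (\<lambda>m m'. separated (snd m) (snd m')) (split_movers e p q (stretch rot d as' as))"
  using assms(5,2-4)
proof (induction as' as arbitrary: d p q rule: list_all2_induct)
  case Nil
  then show ?case by simp
next
  case (Cons a' as' a as)
  note r = rot_cardinal[OF rot Cons.prems(1)]
  let ?A = "stretch_seg d a' a" and ?B = "stretch rot (rot d) as' as"
  define p' q' where "p' = p + scale a' d" and "q' = q + scale a d"
  let ?M = "split_movers e p q ?A" and ?N = "split_movers e p' q' ?B"
  have pq: "p' = p + sum_list (map fst ?A)" "q' = q + sum_list (split_word ?A)"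
    unfolding p'_def q'_def stretch_seg_words[OF Cons.hyps(1)] by auto
  have split: "split_movers e p q (stretch rot d (a' # as') (a # as)) = butlast ?M @ ?N"
    by (simp add: split_movers_append pq)
  have nest: "nested as'" "nested as" using Cons.prems by simp_all
  have pos: "0 \<notin> set as'" "0 \<notin> set as"
    using Cons.hyps(2) by (auto simp: list_all2_conv_all_nth stretchable_def in_set_conv_nth)
  have S: "sorted_wrt (\<lambda>m m'. separated (snd m) (snd m')) ?N"
    using Cons.IH r(1) nest nested_tl by (metis list.collapse list.sel(2))
  have dA: "fst x = d" if "x \<in> set ?A" for x
    using that by (auto simp: stretch_seg_def split: if_splits)
  have st: "sorted_wrt (\<lambda>m m'. separated (snd m) (snd m')) ?M"
    "\<And>m. m \<in> set ?M \<Longrightarrow> dot (rot d) (fst (snd m)) = dot (rot d) p \<and> dot (rot d) (snd (snd m)) = dot (rot d) q"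
    using split_movers_straight[where bs = ?A and e = e and p = p and q = q, OF r(3,4) dA] by blast+
  have M: "?M = butlast ?M @ [(Inl p', p', q')]"
    using split_movers_last[of e p q ?A] split_movers_hd[of e p q ?A] pq
    by (metis append_butlast_last_id list.distinct(1))
  have SM: "sorted_wrt (\<lambda>m m'. separated (snd m) (snd m')) (butlast ?M @ [(Inl p', p', q')])"
    unfolding M[symmetric] by (rule st(1))
  have "separated (snd m) (snd m')" if m: "m \<in> set (butlast ?M)" and m': "m' \<in> set ?N" for m m'
  proof (cases "m' \<in> set (tl ?N)")
    case True
    have "dot (rot d) p' < dot (rot d) (fst (snd m'))" "dot (rot d) q' < dot (rot d) (snd (snd m'))"
      using split_movers_tl[OF True] nested_spiral_halfplane[OF rot r(1)] nest pos
        stretch_words[OF Cons.hyps(2)] by metis+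
    then show ?thesis
      using st(2)[OF in_set_butlastD[OF m]] r
      unfolding p'_def q'_def by (intro separatedI[of "rot d"]) auto
  next
    \<comment> \<open>The corner lies on the line of the segment itself; it is separated from the
      other movers there as the last mover of the straight piece.\<close>
    case False
    then have "m' = (Inl p', p', q')" using m' split_movers_hd[of e p' q' ?B] by (metis set_ConsD)
    then show ?thesis using SM m by (simp add: sorted_wrt_append)
  qed
  moreover have "sorted_wrt (\<lambda>m m'. separated (snd m) (snd m')) (butlast ?M)"
    using SM by (simp add: sorted_wrt_append)
  ultimately show ?case unfolding split using S by (simp add: sorted_wrt_append)
qed

text \<open>The case of \<open>stretch_separated\<close> in which no edge is split: separated movers
  have different final points. The direction \<open>0\<close> is a dummy, as it would only label new
  nodes.\<close>

lemma distinct_spiral: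
  assumes "rot \<in> {rot_ccw, rot_cw}" "d \<in> cardinal_dirs" "nested (tl as)" "0 \<notin> set as"
  shows "distinct (pts p (spiral_word rot d as))"
proof -
  have l: "list_all2 stretchable as as"
    using assms(4) by (auto simp: list_all2_conv_all_nth stretchable_def) (metis gr0I nth_mem)
  have "sorted_wrt (\<lambda>m m'. m \<noteq> m') (map (snd \<circ> snd) (split_movers 0 p p (stretch rot d as as)))"
    unfolding sorted_wrt_map
    by (rule sorted_wrt_mono_rel[OF _ stretch_separated[OF assms(1-3,3) l]]) (auto simp: separated_def)
  moreover have "sorted_wrt (\<noteq>) xs \<Longrightarrow> distinct xs" for xs :: "pt list"
    by (induction xs) auto
  ultimately show ?thesis
    unfolding map_split_movers stretch_words[OF l] by blast
qed

lemma valid_step_stretch: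
  assumes rot: "rot \<in> {rot_ccw, rot_cw}" and d: "d \<in> cardinal_dirs" "e \<in> cardinal_dirs"
    and "nested (tl as')" "nested (tl as)" and l: "list_all2 stretchable as' as"
    and par: "\<And>w. (w, True) \<in> set (stretch rot d as' as) \<Longrightarrow> w = e \<or> w = - e"
  shows "valid_step (path_shape (pts p (spiral_word rot d as'))) p (path_shape (pts p (spiral_word rot d as)))"
proof -
  have "0 \<notin> set as'"
    using l by (auto simp: list_all2_conv_all_nth stretchable_def in_set_conv_nth)
  then have "distinct (pts p (spiral_word rot d as'))"
    using distinct_spiral assms by blast
  then show ?thesis
    using valid_step_split[of p "stretch rot d as' as" e, OF _ d(2) par stretch_separated] assms
    by (simp add: stretch_words[OF l])
qed

section \<open>Halving the excess over the tightest spiral\<close>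

text \<open>In a nested list a segment followed by \<open>r\<close> further ones has length at least
\<open>(r + 2) div 2\<close>; halving the excess over this bound keeps the list nested.\<close>

fun halve :: "bool \<Rightarrow> nat list \<Rightarrow> nat list" where
  "halve b [] = []"
| "halve b (a # as) = (if b then (length as + 2) div 2 + (a - (length as + 2) div 2) div 2 else a)
     # halve (\<not> b) as"

lemma length_halve [simp]: "length (halve b as) = length as"
  by (induction b as rule: halve.induct) auto

text \<open>Two segments further in, the bound drops by exactly one and the length by at least one;
  the two innermost segments have bound \<open>1\<close>.\<close>

lemma nested_lower_bound:
  assumes "nested (a # as)" "0 \<notin> set (a # as)"
  shows "(length as + 2) div 2 \<le> a"
  using assms
proof (induction as arbitrary: a rule: length_induct)
  case (1 as)
  show ?case
  proof (cases "2 \<le> length as")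
    case True
    then obtain b c es where as: "as = b # c # es"
      by (metis Suc_le_length_iff numeral_2_eq_2)
    then have "c < a" "nested (c # es)" "0 \<notin> set (c # es)"
      using 1(2,3) by (auto dest: nested_tl)
    then have "(length es + 2) div 2 \<le> c" using 1(1)[rule_format, of es c] as by simp
    then show ?thesis using \<open>c < a\<close> as by simp
  next
    case False
    then show ?thesis using 1(3) by auto
  qed
qed

text \<open>A segment and the second next one are parallel, so both are halved or neither is. Their
  bounds differ by one, so a strict inequality of lengths is a weak one of excesses, and halving is
  monotone.\<close>

lemma nested_halve:
  assumes "nested as" "0 \<notin> set as"
  shows "nested (halve b as)"
  using assms
proof (induction as arbitrary: b rule: nested.induct)
  case (1 x y z as)
  have "nested (z # as)" "z < x" using 1(2) by (auto dest: nested_tl)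
  then have "(length as + 2) div 2 \<le> z"
    using 1(3) nested_lower_bound by simp
  moreover have "nested (halve (\<not> b) (y # z # as))" 
    using "1.IH"[of "\<not> b"] 1(2,3) by (simp del: halve.simps)
  ultimately show ?case using \<open>z < x\<close> by auto
qed auto

text \<open>Rounding the halved excess down loses at most one edge when the new length is doubled;
  the doubled bound, which is at least one too large, makes up for it.\<close>

lemma halve_stretchable:
  assumes "nested as" "0 \<notin> set as"
  shows "list_all2 stretchable (halve b as) as"
  using assms
proof (induction as arbitrary: b)
  case (Cons a as)
  then show ?case using nested_lower_bound[of a as] nested_tl[of a as] by (auto simp: stretchable_def)
qed simp

text \<open>The axis of the segments and the flag \<open>b\<close> alternate together, and
  \<open>rot (rot d) = - d\<close>; hence all splits lie on one axis and fit into a single time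
  step.\<close>

lemma stretch_halve_dir:
  assumes "rot \<in> {rot_ccw, rot_cw}" "d \<in> cardinal_dirs" "(w, True) \<in> set (stretch rot d (halve b as) as)"
  shows "w = (if b then d else rot d) \<or> w = - (if b then d else rot d)"
  using assms(2,3)
proof (induction as arbitrary: b d)
  case (Cons a as)
  note r = rot_cardinal[OF assms(1) Cons.prems(1)]
  from Cons.prems(2) consider "b" "w = d" | "(w, True) \<in> set (stretch rot (rot d) (halve (\<not> b) as) as)"
    by (auto simp: stretch_seg_def split: if_splits)
  then show ?case
  proof cases
    case 2
    then show ?thesis using Cons.IH[OF r(1) 2] r(2) by auto
  qed simp
qed simp

text \<open>The two bounds swap at every segment: \<open>M\<close> belongs to the axis of the first
  segment, \<open>N\<close> to the other one.\<close>

fun excess_less :: "nat \<Rightarrow> nat \<Rightarrow> nat list \<Rightarrow> bool" where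
  "excess_less M N [] \<longleftrightarrow> True"
| "excess_less M N (a # as) \<longleftrightarrow> a - (length as + 2) div 2 < M \<and> excess_less N M as"

lemma excess_less_halve:
  "excess_less (2 * M) N as \<Longrightarrow> excess_less M N (halve True as)"
  "excess_less N (2 * M) as \<Longrightarrow> excess_less N M (halve False as)"
  by (induction as arbitrary: M N) auto

text \<open>The outermost segment is subject to no nesting condition, so only its excess over \<open>1\<close> counts.\<close>

fun halve_spiral :: "bool \<Rightarrow> nat list \<Rightarrow> nat list" where
  "halve_spiral b [] = []"
| "halve_spiral b (a # as) = (if b then 1 + (a - 1) div 2 else a) # halve (\<not> b) as"

fun spiral_excess_less :: "nat \<Rightarrow> nat \<Rightarrow> nat list \<Rightarrow> bool" where
  "spiral_excess_less M N [] \<longleftrightarrow> True"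
| "spiral_excess_less M N (a # as) \<longleftrightarrow> a - 1 < M \<and> excess_less N M as"

lemma spiral_excess_less_halve:
  "spiral_excess_less (2 * M) N as \<Longrightarrow> spiral_excess_less M N (halve_spiral True as)"
  "spiral_excess_less N (2 * M) as \<Longrightarrow> spiral_excess_less N M (halve_spiral False as)"
  by (cases as; auto simp: excess_less_halve)+

lemma halve_spiral_props:
  assumes "nested (tl as)" "0 \<notin> set as"
  shows "nested (tl (halve_spiral b as))" "0 \<notin> set (halve_spiral b as)"
    "length (halve_spiral b as) = length as" "list_all2 stretchable (halve_spiral b as) as"
proof -
  show "nested (tl (halve_spiral b as))" 
    using assms by (cases as) (auto simp: nested_halve)
  show "length (halve_spiral b as) = length as"
    by (cases as) auto
  show l: "list_all2 stretchable (halve_spiral b as) as"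
    using assms by (cases as) (auto simp: halve_stretchable, auto simp: stretchable_def)
  then show "0 \<notin> set (halve_spiral b as)"
    by (auto simp: list_all2_conv_all_nth stretchable_def in_set_conv_nth)
qed

lemma valid_step_halve_spiral:
  assumes rot: "rot \<in> {rot_ccw, rot_cw}" and d: "d \<in> cardinal_dirs"
    and "nested (tl as)" "0 \<notin> set as"
  shows "valid_step (path_shape (pts p (spiral_word rot d (halve_spiral b as)))) p
    (path_shape (pts p (spiral_word rot d as)))"
proof -
  note r = rot_cardinal[OF rot d]
  define e where "e = (if b then d else rot d)"
  have "e \<in> cardinal_dirs" using r d by (simp add: e_def)
  moreover have "w = e \<or> w = - e" if w: "(w, True) \<in> set (stretch rot d (halve_spiral b as) as)" for w
  proof (cases as)
    case Nil
    then show ?thesis using w by simp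
  next
    case (Cons a bs)
    from w consider "b" "w = d" | "(w, True) \<in> set (stretch rot (rot d) (halve (\<not> b) bs) bs)"
      by (auto simp: Cons stretch_seg_def split: if_splits)
    then show ?thesis
    proof cases
      case 2
      then show ?thesis using stretch_halve_dir[OF rot r(1) 2] r(2) by (auto simp: e_def)
    qed (simp add: e_def)
  qed
  ultimately show ?thesis
    using valid_step_stretch[OF rot d] halve_spiral_props[OF assms(3,4)] assms(3) by blast
qed

section \<open>Growing a spiral from its external endpoint\<close>

lemma grows_in_step:
  assumes "grows_in S0 a S t" "valid_step S a S'"
  shows "grows_in S0 a S' (Suc t)"
proof -
  obtain seq :: "nat \<Rightarrow> shape" where "a \<in> fst S0" "seq 0 = S0" "seq t = S" "\<forall>i < t. valid_step (seq i) a (seq (Suc i))"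
    using assms(1) by (auto simp: grows_in_def)
  then show ?thesis
    unfolding grows_in_def using assms(2)
    by (intro conjI exI[of _ "seq(Suc t := S')"]) (auto simp: less_Suc_eq)
qed

lemma nested_butlast: "nested (as @ [x]) \<Longrightarrow> nested as"
  by (induction as rule: nested.induct) auto

text \<open>Without the innermost segment every remaining one has one successor fewer, which lowers
  its bound by at most one and raises its excess from \<open>0\<close> to at most
  \<open>1\<close>.\<close>

lemma excess_less_snoc:
  "excess_less 1 1 (as @ [x]) \<Longrightarrow> excess_less 2 2 as \<and> x \<le> 1"
  by (induction as) auto

lemma spiral_word_snoc:
  assumes "rot \<in> {rot_ccw, rot_cw}" "d \<in> cardinal_dirs"
  shows "\<exists>e \<in> cardinal_dirs. spiral_word rot d (as @ [1]) = spiral_word rot d as @ [e]"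
  using assms(2)
proof (induction as arbitrary: d)
  case (Cons a as)
  then show ?case using rot_cardinal(1)[OF assms(1)] by fastforce
qed auto

text \<open>The outer induction removes innermost segments, the inner one on \<open>L\<close> halves
  the excesses at two steps per round. Each segment costs three steps: one for its last edge and two
  for the round that makes the remaining spiral tight again.\<close>

lemma grows_in_spiral:
  assumes rot: "rot \<in> {rot_ccw, rot_cw}" and d: "d \<in> cardinal_dirs"
    and "nested (tl as)" "0 \<notin> set as" "spiral_excess_less (2 ^ L) (2 ^ L) as"
  shows "\<exists>t \<le> 2 * L + 3 * length as. grows_in ({p}, {}) p (path_shape (pts p (spiral_word rot d as))) t"
  using assms(3-)
proof (induction "length as" arbitrary: as L)
  case 0
  then have "path_shape (pts p (spiral_word rot d as)) = ({p}, {})"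
    by (simp add: path_shape_def)
  then show ?case by (intro exI[of _ 0]) (auto simp: grows_in_def)
next
  case (Suc n)
  note outer = Suc.hyps(1)
  from Suc.prems Suc.hyps(2) show ?case
  proof (induction L arbitrary: as)
    case 0
    obtain bs x where as: "as = bs @ [x]" using 0(4) by (metis length_Suc_conv_rev)
    have "x = 1 \<and> spiral_excess_less 2 2 bs"
    proof (cases bs)
      case Nil
      then show ?thesis using 0 as by auto
    next
      case (Cons b bs')
      then show ?thesis using 0 as excess_less_snoc[of bs' x] by (auto simp: le_Suc_eq)
    qed
    moreover have "nested (tl bs)"
      using 0(1) as nested_butlast[of "tl bs" x] by (cases bs) auto
    \<comment> \<open>The outer hypothesis is used with exponent \<open>1\<close>, because the
      excesses of \<open>bs\<close> are only known to be below \<open>2\<close>.\<close>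
    ultimately have "\<exists>t \<le> 2 * 1 + 3 * length bs. grows_in ({p}, {}) p (path_shape (pts p (spiral_word rot d bs))) t"
      using outer[of bs 1] 0 as by simp
    then obtain t where t: "t \<le> 2 + 3 * length bs"
      "grows_in ({p}, {}) p (path_shape (pts p (spiral_word rot d bs))) t" by auto
    obtain e where e: "e \<in> cardinal_dirs" "spiral_word rot d as = spiral_word rot d bs @ [e]"
      using spiral_word_snoc[OF rot d, of bs] as \<open>x = 1 \<and> _\<close> by auto
    let ?xs = "pts p (spiral_word rot d bs)"
    have pa: "pts p (spiral_word rot d as) = ?xs @ [last ?xs + e]"
      by (simp add: e(2) pts_append last_pts)
    have "distinct (?xs @ [last ?xs + e])"
      using distinct_spiral[OF rot d 0(1,2), of p] pa by simp
    then have "valid_step (path_shape ?xs) p (path_shape (pts p (spiral_word rot d as)))"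
      unfolding pa using valid_step_extend[OF _ _ e(1)] by simp
    then have "grows_in ({p}, {}) p (path_shape (pts p (spiral_word rot d as))) (Suc t)"
      using t(2) grows_in_step by blast
    then show ?case using t(1) as by (intro exI[of _ "Suc t"]) auto
  next
    case (Suc L)
    \<comment> \<open>Seen forwards, \<open>?as2\<close> is stretched to \<open>?as1\<close> on the
      axis perpendicular to \<open>d\<close>, and then \<open>?as1\<close> to \<open>as\<close> on
      the axis of \<open>d\<close>.\<close>
    let ?as1 = "halve_spiral True as"
    let ?as2 = "halve_spiral False ?as1"
    note h1 = halve_spiral_props[OF Suc.prems(1,2), of True]
    note h2 = halve_spiral_props[OF h1(1,2), of False]
    have "spiral_excess_less (2 ^ L) (2 ^ L) ?as2"
      using Suc.prems(3) by (intro spiral_excess_less_halve) simp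
    then obtain t where t: "t \<le> 2 * L + 3 * length as"
      "grows_in ({p}, {}) p (path_shape (pts p (spiral_word rot d ?as2))) t"
      using Suc.IH[of ?as2] h1 h2 Suc.prems by auto
    have "grows_in ({p}, {}) p (path_shape (pts p (spiral_word rot d as))) (Suc (Suc t))"
      using t(2) grows_in_step valid_step_halve_spiral[OF rot d] h1 Suc.prems by blast
    then show ?case using t(1) by (intro exI[of _ "Suc (Suc t)"]) auto
  qed
qed

section \<open>The segment lengths of a spiral\<close>

lemma mem_tl_pts:
  assumes "0 < k" "k \<le> length ws"
  shows "p + sum_list (take k ws) \<in> set (tl (pts p ws))"
proof -
  have "tl (pts p ws) ! (k - 1) = p + sum_list (take k ws)"
    using assms by (simp add: nth_tl nth_pts)
  then show ?thesis using assms by (metis One_nat_def diff_less length_pts length_tl diff_Suc_1 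
        less_imp_diff_less nth_mem order_le_less_trans zero_less_one Suc_pred less_eq_Suc_le)
qed

text \<open>Seen from the corner at its end, a segment already traversed blocks the points behind
  the corner up to its own length. This supplies the last hypothesis of
  \<open>nested_if_distinct\<close> for the next segment.\<close>

lemma segment_wall:
  assumes "distinct (pts q (replicate b f @ ws))" "s \<le> b"
  shows "q + scale b f + scale s (- f) \<notin> set (tl (pts (q + scale b f) ws))"
    "distinct (pts (q + scale b f) ws)"
proof -
  have dis: "set (pts q (replicate b f)) \<inter> set (tl (pts (q + scale b f) ws)) = {}"
    "distinct (tl (pts (q + scale b f) ws))"
    using assms(1) by (auto simp: pts_append)
  have "scale b f = scale (b - s) f + scale s f"
    using assms(2) by (simp add: scale_add[symmetric])
  then have "q + scale b f + scale s (- f) = q + scale (b - s) f"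
    by (simp add: scale_uminus algebra_simps)
  then have "q + scale b f + scale s (- f) \<in> set (pts q (replicate b f))"
    by (simp add: set_pts_replicate)
  then show "q + scale b f + scale s (- f) \<notin> set (tl (pts (q + scale b f) ws))"
    using dis by blast
  have "q + scale b f \<in> set (pts q (replicate b f))"
    by (auto simp: set_pts_replicate)
  moreover have "pts (q + scale b f) ws = (q + scale b f) # tl (pts (q + scale b f) ws)"
    by (cases ws) auto
  ultimately show "distinct (pts (q + scale b f) ws)"
    using dis by (metis disjoint_iff distinct.simps(2))
qed

text \<open>If the fourth of four consecutive segments were at least as long as the second, it would run
into the first one.\<close>

lemma nested_if_distinct:
  assumes "rot \<in> {rot_ccw, rot_cw}" "f \<in> cardinal_dirs" "0 \<notin> set bs"
    and "distinct (pts q (spiral_word rot f bs))"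
    and "\<And>s. s \<le> nth0 bs 1 \<Longrightarrow> q + scale s (rot f) \<notin> set (tl (pts q (spiral_word rot f bs)))"
  shows "nested bs"
  using assms(2-)
proof (induction bs arbitrary: q f rule: nested.induct)
  case (1 b c e rest)
  note r = rot_cardinal[OF assms(1) 1(2)]
  let ?W = "spiral_word rot f (b # c # e # rest)"
  have "e < b"
  proof (rule ccontr)
    \<comment> \<open>After \<open>b\<close> steps of the third segment the moves along
      \<open>f\<close> and \<open>- f\<close> cancel, and the path is at
      \<open>q + scale c (rot f)\<close>, a point of the wall behind \<open>q\<close>.\<close>
    assume "\<not> e < b"
    then have "take (b + c + b) ?W = replicate b f @ replicate c (rot f) @ replicate b (- f)"
      using r by simp
    then have "q + sum_list (take (b + c + b) ?W) = q + scale c (rot f)"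
      by (simp add: scale_uminus)
    moreover have "q + sum_list (take (b + c + b) ?W) \<in> set (tl (pts q ?W))"
      using \<open>\<not> e < b\<close> 1(3) by (intro mem_tl_pts) auto
    moreover have "c \<le> nth0 (b # c # e # rest) 1" by simp
    ultimately show False using 1(5) by metis
  qed
  moreover have "nested (c # e # rest)"
  proof (rule "1.IH"[OF r(1)])
    have dist: "distinct (pts q (replicate b f @ spiral_word rot (rot f) (c # e # rest)))"
      using 1(4) by simp
    show "0 \<notin> set (c # e # rest)" using 1(3) by simp
    show "distinct (pts (q + scale b f) (spiral_word rot (rot f) (c # e # rest)))"
      using segment_wall(2)[OF dist, of 0] by simp
    \<comment> \<open>The wall is now needed only up to length \<open>e\<close>, and the segment of
      length \<open>b > e\<close> just traversed provides it.\<close>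
    show "q + scale b f + scale s (rot (rot f)) \<notin>
        set (tl (pts (q + scale b f) (spiral_word rot (rot f) (c # e # rest))))"
      if "s \<le> nth0 (c # e # rest) 1" for s
      using segment_wall(1)[OF dist, of s] that \<open>e < b\<close> r(2) by simp
  qed
  ultimately show ?case by simp
qed auto

section \<open>From the word of steps to segment lengths and turning points\<close>

fun turns :: "'a list \<Rightarrow> nat" where
  "turns (x # y # zs) = (if x = y then 0 else 1) + turns (y # zs)"
| "turns _ = 0"

lemma turns_eq_card: "turns ws = card {i. Suc i < length ws \<and> ws ! i \<noteq> ws ! Suc i}"
proof (induction ws rule: turns.induct)
  case (1 x y zs)
  let ?T = "\<lambda>ws. {i. Suc i < length ws \<and> ws ! i \<noteq> ws ! Suc i}"
  have "?T (x # y # zs) = (if x = y then {} else {0}) \<union> Suc ` ?T (y # zs)"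
  proof (rule set_eqI)
    fix i show "i \<in> ?T (x # y # zs) \<longleftrightarrow> i \<in> (if x = y then {} else {0}) \<union> Suc ` ?T (y # zs)"
      by (cases i) auto
  qed
  moreover have "finite (?T (y # zs))" by (rule finite_subset[of _ "{..length (y # zs)}"]) auto
  ultimately show ?case using 1 by (auto simp: card_image card_insert_if)
qed auto

text \<open>The segments are the maximal runs of equal letters, so there is one more of them than
  changes. A letter put in front lengthens the first run or opens a run of length
  \<open>1\<close>.\<close>

lemma word_eq_spiral_word:
  assumes "ws \<noteq> []" "\<And>i. Suc i < length ws \<Longrightarrow> ws ! Suc i = ws ! i \<or> ws ! Suc i = rot (ws ! i)"
  shows "\<exists>as. ws = spiral_word rot (hd ws) as \<and> 0 \<notin> set as \<and> length as = Suc (turns ws)"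
  using assms
proof (induction ws rule: turns.induct)
  case (1 x y zs)
  have "(y # zs) ! Suc i = (y # zs) ! i \<or> (y # zs) ! Suc i = rot ((y # zs) ! i)" if "Suc i < length (y # zs)" for i
    using 1(3)[of "Suc i"] that by simp
  then obtain as where as: "y # zs = spiral_word rot y as" "0 \<notin> set as" "length as = Suc (turns (y # zs))"
    using 1(1) by auto
  show ?case
  proof (cases "x = y")
    case True
    obtain a bs where ab: "as = a # bs" using as(3) by (cases as) auto
    have "x # y # zs = spiral_word rot x (Suc a # bs)" using as(1) ab True by simp
    moreover have "length (Suc a # bs) = Suc (turns (x # y # zs))" using as(3) ab True by simp
    moreover have "0 \<notin> set (Suc a # bs)" using as(2) ab by simp
    ultimately show ?thesis by (metis list.sel(1))
  next
    case False
    then have "y = rot x" using 1(3)[of 0] by simp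
    then have "x # y # zs = spiral_word rot x (1 # as)" using as(1) by simp
    moreover have "length (1 # as) = Suc (turns (x # y # zs))" using as(3) False by simp
    moreover have "0 \<notin> set (1 # as)" using as(2) by simp
    ultimately show ?thesis by (metis list.sel(1))
  qed
next
  case ("2_2" x)
  then show ?case by (intro exI[of _ "[1]"]) auto
qed auto

lemma list_eq_pts:
  assumes "xs \<noteq> []"
  obtains ws where "xs = pts (hd xs) ws" "length xs = Suc (length ws)"
    "\<And>i. i < length ws \<Longrightarrow> ws ! i = xs ! Suc i - xs ! i"
proof -
  have "\<exists>ws. xs = pts (hd xs) ws"
    using assms
  proof (induction xs rule: induct_list012)
    case (2 x)
    then show ?case by (intro exI[of _ "[]"]) auto
  next
    case (3 x y zs)
    then obtain ws where "y # zs = pts y ws" by auto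
    then show ?case by (intro exI[of _ "(y - x) # ws"]) auto
  qed simp
  then obtain ws where ws: "xs = pts (hd xs) ws" by blast
  have "ws ! i = xs ! Suc i - xs ! i" if "i < length ws" for i
    using that by (subst (1 2) ws) (simp add: nth_pts take_Suc_conv_app_nth)
  then show ?thesis using that ws by (metis length_pts)
qed

lemma excess_less_bounded: "(\<And>a. a \<in> set as \<Longrightarrow> a < M \<and> a < N) \<Longrightarrow> excess_less M N as"
  by (induction as arbitrary: M N) (auto simp: less_imp_diff_less)

lemma length_spiral_word: "length (spiral_word rot d as) = sum_list as"
  by (induction as arbitrary: d) auto

lemma spiral_lengths:
  assumes "spiral ps" "last_is_external ps" "2 \<le> length ps"
  obtains rot d as where "rot \<in> {rot_ccw, rot_cw}" "d \<in> cardinal_dirs"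
    "rev ps = pts (last ps) (spiral_word rot d as)" "nested (tl as)" "0 \<notin> set as"
    "length as \<le> num_turning_points ps"
proof -
  let ?n = "length ps"
  let ?p = "last ps"
  have dist: "distinct ps" and ne: "ps \<noteq> []" using assms(1) by (auto simp: spiral_def grid_path_def)
  obtain rt where rt: "rt \<in> {rot_ccw, rot_cw}" and turn: "\<And>i. Suc (Suc i) < ?n \<Longrightarrow>
        step_dir ps (Suc i) = step_dir ps i \<or> step_dir ps (Suc i) = rt (step_dir ps i)"
    using assms(1) by (auto simp: spiral_def)
  \<comment> \<open>Reading backwards reverses the order of the steps and negates them:
    \<open>v\<close> followed by \<open>rt v\<close> becomes \<open>- rt v\<close> followed by
    \<open>- v\<close>. So \<open>rot\<close> is the inverse rotation.\<close>
  obtain rot where rot: "rot \<in> {rot_ccw, rot_cw}" and rot_rt: "\<And>v. rot (- rt v) = - v"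
  proof (cases "rt = rot_ccw")
    case True
    then show ?thesis using that[of rot_cw] by (simp add: rot_ccw_def rot_cw_def prod_eq_iff)
  next
    case False
    then have "rt = rot_cw" using rt by simp
    then show ?thesis using that[of rot_ccw] by (simp add: rot_ccw_def rot_cw_def prod_eq_iff)
  qed
  obtain ws where ws: "rev ps = pts ?p ws" "?n = Suc (length ws)"
    "\<And>i. i < length ws \<Longrightarrow> ws ! i = rev ps ! Suc i - rev ps ! i"
    using list_eq_pts[of "rev ps"] ne by (metis hd_rev length_rev rev_is_Nil_conv)
  have wsd: "ws ! i = - step_dir ps (?n - 2 - i)" if "i < length ws" for i
    using that ws(2) ws(3)[OF that] by (simp add: rev_nth step_dir_def Suc_diff_Suc)
  have card: "step_dir ps i \<in> cardinal_dirs" if "Suc i < ?n" for i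
  proof -
    have "grid_adj (ps ! i) (ps ! Suc i)" using assms(1) that by (auto simp: spiral_def grid_path_def)
    then show ?thesis
      unfolding grid_adj_def step_dir_def cardinal_dirs_def
      by (cases "ps ! i"; cases "ps ! Suc i") (auto simp: abs_if split: if_splits)
  qed
  have neg: "- v \<in> cardinal_dirs" if "v \<in> cardinal_dirs" for v
    using that by (auto simp: cardinal_dirs_def)
  have wne: "ws \<noteq> []" using ws(2) assms(3) by auto
  have step: "ws ! Suc i = ws ! i \<or> ws ! Suc i = rot (ws ! i)" if i: "Suc i < length ws" for i
  proof -
    define j where "j = ?n - 2 - Suc i"
    have j: "?n - 2 - i = Suc j" "Suc (Suc j) < ?n" using i ws(2) by (auto simp: j_def)
    have "ws ! Suc i = - step_dir ps j" "ws ! i = - step_dir ps (Suc j)"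
      using wsd[of i] wsd[of "Suc i"] i j j_def by auto
    then show ?thesis using turn[OF j(2)] rot_rt by metis
  qed
  obtain as where as: "ws = spiral_word rot (hd ws) as" "0 \<notin> set as" "length as = Suc (turns ws)"
    using word_eq_spiral_word[of ws rot, OF wne step] by blast
  define d where "d = hd ws"
  have d: "d = - step_dir ps (?n - 2)" using wsd[of 0] wne by (simp add: d_def hd_conv_nth)
  have dcard: "d \<in> cardinal_dirs" unfolding d using assms(3) by (intro neg card) simp
  note r = rot_cardinal[OF rot dcard]
  obtain a bs where ab: "as = a # bs" using as(3) by (cases as) auto
  have path: "rev ps = pts ?p (spiral_word rot d as)" using ws(1) as(1) by (simp add: d_def)
  have dist': "distinct (pts ?p (replicate a d @ spiral_word rot (rot d) bs))"
    using dist path ab by (metis distinct_rev spiral_word.simps(2))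
  have "nested bs"
  proof (rule nested_if_distinct[OF rot r(1)])
    show "0 \<notin> set bs" using as(2) ab by simp
    show "distinct (pts (?p + scale a d) (spiral_word rot (rot d) bs))"
      using segment_wall(2)[OF dist', of 0] by simp
    fix s
    show "?p + scale a d + scale s (rot (rot d)) \<notin> set (tl (pts (?p + scale a d) (spiral_word rot (rot d) bs)))"
    \<comment> \<open>Up to distance \<open>a\<close> the wall is the outermost segment. Beyond the
      external endpoint it is the outward ray, which is free of nodes by
      \<open>last_is_external\<close>; the point at distance \<open>s\<close> is its point number
      \<open>s - a\<close>.\<close>
    proof (cases "s \<le> a")
      case True
      then show ?thesis using segment_wall(1)[OF dist' True] r(2) by simp
    next
      case False
      define m where "m = s - a"
      have m: "1 \<le> m" "s = a + m" using False by (auto simp: m_def)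
      have eq: "?p + scale a d + scale s (rot (rot d)) =
        (fst ?p + int m * fst (step_dir ps (?n - 2)), snd ?p + int m * snd (step_dir ps (?n - 2)))"
        unfolding r(2) m(2) unfolding d by (simp add: scale_def prod_eq_iff algebra_simps)
      have "\<dots> \<notin> set ps"
        using assms(2,3) m(1) by (auto simp: last_is_external_def Let_def)
      moreover have "set (tl (pts (?p + scale a d) (spiral_word rot (rot d) bs))) \<subseteq> set ps"
        using arg_cong[OF path, of set] by (auto simp: ab pts_append)
      ultimately show ?thesis unfolding eq by blast
    qed
  qed
  moreover have "length as \<le> num_turning_points ps"
  proof -
    let ?T = "{i. Suc i < length ws \<and> ws ! i \<noteq> ws ! Suc i}"
    let ?U = "{i. turning_point ps i}"
    have fin: "finite ?U" by (rule finite_subset[of _ "{..<?n}"]) (auto simp: turning_point_def)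
    \<comment> \<open>A change of letter at \<open>i\<close> is a turn at node
      \<open>?n - 2 - i\<close>, which is not node \<open>0\<close>. The endpoint \<open>0\<close>
      is a further turning point and accounts for the \<open>Suc\<close> in the number of
      segments.\<close>
    have T: "turning_point ps (?n - 2 - i) \<and> ?n - 2 - i \<noteq> 0" if i: "i \<in> ?T" for i
    proof -
      define j where "j = ?n - 2 - Suc i"
      have j: "?n - 2 - i = Suc j" "Suc (Suc j) < ?n" using i ws(2) by (auto simp: j_def)
      have "ws ! Suc i = - step_dir ps j" "ws ! i = - step_dir ps (Suc j)"
        using wsd[of i] wsd[of "Suc i"] i j j_def by auto
      then have "step_dir ps (Suc j) = rt (step_dir ps j)" using turn[OF j(2)] i by auto
      then have "perp (step_dir ps j) (step_dir ps (Suc j))"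
        using rt by (auto simp: perp_def rot_ccw_def rot_cw_def)
      then show ?thesis using j by (simp add: turning_point_def)
    qed
    have "turning_point ps 0" using ne by (simp add: turning_point_def)
    then have sub: "insert 0 ((\<lambda>i. ?n - 2 - i) ` ?T) \<subseteq> ?U" using T by blast
    have "0 \<notin> (\<lambda>i. ?n - 2 - i) ` ?T" using T by fastforce
    moreover have "inj_on (\<lambda>i. ?n - 2 - i) ?T" using ws(2) by (auto simp: inj_on_def)
    moreover have "finite ?T" by (rule finite_subset[of _ "{..length ws}"]) auto
    ultimately have "Suc (card ?T) \<le> card ?U"
      using card_mono[OF fin sub] by (simp add: card_image)
    then show ?thesis using as(3) by (simp add: turns_eq_card num_turning_points_def)
  qed
  ultimately show ?thesis using that[OF rot dcard path] as(2) ab by simp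
qed

section \<open>The logarithmic bound on the number of steps\<close>

theorem theorem3p3:
  fixes c :: real
  shows "\<exists>C::real. \<forall>ps.
           spiral ps \<and> last_is_external ps \<and>
           real (num_turning_points ps) \<le> c * log 2 (real (length ps)) \<longrightarrow>
           (\<exists>t::nat. real t \<le> C * log 2 (real (length ps)) \<and>
              grows_in ({last ps}, {}) (last ps) (path_shape ps) t)"
proof (intro exI[of _ "4 + 3 * c"] allI impI)
  fix ps
  assume "spiral ps \<and> last_is_external ps \<and>
           real (num_turning_points ps) \<le> c * log 2 (real (length ps))"
  then have ps: "spiral ps" "last_is_external ps"
    and k: "real (num_turning_points ps) \<le> c * log 2 (real (length ps))" by auto
  have ne: "ps \<noteq> []" using ps by (auto simp: spiral_def grid_path_def)
  \<comment> \<open>A single node has one turning point, but its bound is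
    \<open>c * log 2 1 = 0\<close>.\<close>
  have len: "2 \<le> length ps"
  proof (rule ccontr)
    assume "\<not> 2 \<le> length ps"
    moreover have "length ps \<noteq> 0" using ne by simp
    ultimately have 1: "length ps = 1" by linarith
    then have "{i. turning_point ps i} = {0}" by (auto simp: turning_point_def)
    then show False using k 1 by (simp add: num_turning_points_def)
  qed
  obtain rot d as where s: "rot \<in> {rot_ccw, rot_cw}" "d \<in> cardinal_dirs"
    "rev ps = pts (last ps) (spiral_word rot d as)" "nested (tl as)" "0 \<notin> set as"
    "length as \<le> num_turning_points ps"
    using spiral_lengths[OF ps len] by blast
  define l where "l = log 2 (real (length ps))"
  \<comment> \<open>This choice gives \<open>length ps \<le> 2 ^ L\<close>, so \<open>2 ^ L\<close>
    exceeds every segment length and hence every excess.\<close>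
  define L where "L = nat \<lceil>l\<rceil>"
  have "log 2 2 \<le> l" unfolding l_def using len by (intro log_mono) auto
  then have l1: "1 \<le> l" by simp
  have "real (length ps) = 2 powr l" using ne by (simp add: l_def)
  also have "\<dots> \<le> 2 powr real L" using l1 by (intro powr_mono) (auto simp: L_def real_nat_ceiling_ge)
  also have "\<dots> = real (2 ^ L)" by (simp add: powr_realpow)
  finally have nL: "length ps \<le> 2 ^ L" by (simp only: of_nat_le_iff)
  \<comment> \<open>As \<open>l \<ge> 1\<close>, rounding up at most doubles it. Thus
    \<open>2 * L\<close> accounts for the \<open>4\<close>, and \<open>3 * length as\<close> for the
    \<open>3 * c\<close>, in the constant.\<close>
  have LL: "real L \<le> 2 * l" using l1 unfolding L_def by linarith
  have small: "a < 2 ^ L" if "a \<in> set as" for a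
  proof -
    have "a \<le> sum_list as" using that by (intro member_le_sum_list) auto
    also have "\<dots> < length ps"
      using arg_cong[OF s(3), of length] by (simp add: length_spiral_word)
    finally show ?thesis using nL by simp
  qed
  have "spiral_excess_less (2 ^ L) (2 ^ L) as"
    using small by (cases as) (auto simp: excess_less_bounded less_imp_diff_less)
  then obtain t where t: "t \<le> 2 * L + 3 * length as"
    "grows_in ({last ps}, {}) (last ps) (path_shape (pts (last ps) (spiral_word rot d as))) t"
    using grows_in_spiral[OF s(1,2,4,5)] by blast
  have "real t \<le> 2 * real L + 3 * real (length as)" using t(1) by linarith
  also have "\<dots> \<le> (4 + 3 * c) * l" using LL k s(6) by (simp add: l_def algebra_simps)
  finally have "real t \<le> (4 + 3 * c) * log 2 (real (length ps))" by (simp add: l_def)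
  moreover have "grows_in ({last ps}, {}) (last ps) (path_shape ps) t"
    using t(2) unfolding s(3)[symmetric] path_shape_rev .
  ultimately show "\<exists>t::nat. real t \<le> (4 + 3 * c) * log 2 (real (length ps)) \<and>
              grows_in ({last ps}, {}) (last ps) (path_shape ps) t" by blast
qed

end
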